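(* For every integer $k\ge 3$ there exist an integer $n_0(k)$ and positive constants $c_1$ and $c_2$, depending only on $k$, such that for all integers $n\ge n_0(k)$, $$\frac{c_1 n^{\frac{k}{k-1}}}{(\log n)^{\frac{1}{k-1}}}\ \le\ \vartheta_s(n,k)\ \le\ c_2\, n^{\frac{k}{k-1}}\log n .$$
   Context: A $k$-graph $G$ is a $k$-uniform hypergraph (identified with its edge set) on a finite vertex set $V(G)$; its complement $\overline{G}$ is the $k$-graph on $V(G)$ whose edges are the $k$-subsets of $V(G)$ that are not edges of $G$. A set $I\subseteq V(G)$ is independent in $G$ if it contains no edge of $G$. $\vartheta(G)$ is the minimum $t$ such that there exist independent sets $I_1,\dots,I_t$ of $G$ with every edge of $\overline{G}$ contained in some $I_j$. A $k$-graph is simple if any two distinct edges share at most one vertex (equivalently, every pair of vertices lies in at most one edge). $\vartheta_s(n,k)$ is the maximum of $\vartheta(G)$ over all simple $k$-graphs $G$ on $n$ vertices. *)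

theory Defs
  imports Complex_Main "HOL-Library.Ramsey"
begin

text \<open>A \<open>k\<close>-graph is given by its vertex set \<open>V\<close> and its edge set \<open>E\<close>; the constant
  \<^const>\<open>nsets\<close> from \<^theory>\<open>HOL-Library.Ramsey\<close> provides the set of all \<open>k\<close>-subsets of \<open>V\<close>.\<close>

definition kgraph :: "nat \<Rightarrow> 'a set \<Rightarrow> 'a set set \<Rightarrow> bool" where
  "kgraph k V E \<longleftrightarrow> finite V \<and> E \<subseteq> nsets V k"

definition kgraph_complement :: "nat \<Rightarrow> 'a set \<Rightarrow> 'a set set \<Rightarrow> 'a set set" where
  "kgraph_complement k V E = nsets V k - E"

definition hindependent :: "'a set \<Rightarrow> 'a set set \<Rightarrow> 'a set \<Rightarrow> bool" where
  "hindependent V E I \<longleftrightarrow> I \<subseteq> V \<and> (\<forall>e\<in>E. \<not> e \<subseteq> I)"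

definition simple_kgraph :: "nat \<Rightarrow> 'a set \<Rightarrow> 'a set set \<Rightarrow> bool" where
  "simple_kgraph k V E \<longleftrightarrow>
     kgraph k V E \<and> (\<forall>e\<in>E. \<forall>f\<in>E. e \<noteq> f \<longrightarrow> card (e \<inter> f) \<le> 1)"

definition indep_cover ::
    "nat \<Rightarrow> 'a set \<Rightarrow> 'a set set \<Rightarrow> nat \<Rightarrow> (nat \<Rightarrow> 'a set) \<Rightarrow> bool" where
  "indep_cover k V E t I \<longleftrightarrow>
     (\<forall>j\<in>{1..t}. hindependent V E (I j)) \<and>
     (\<forall>e\<in>kgraph_complement k V E. \<exists>j\<in>{1..t}. e \<subseteq> I j)"

definition theta :: "nat \<Rightarrow> 'a set \<Rightarrow> 'a set set \<Rightarrow> nat" where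
  "theta k V E = (LEAST t. \<exists>I. indep_cover k V E t I)"

text \<open>The vertices are taken to be natural numbers, which loses no generality; see
  \<open>theta_le_theta_s\<close> below. That \<^const>\<open>Max\<close> is applied to a nonempty finite
  set is \<open>theta_s_attained\<close>.\<close>

definition theta_s :: "nat \<Rightarrow> nat \<Rightarrow> nat" where
  "theta_s n k = Max {theta k V E | (V :: nat set) E. card V = n \<and> simple_kgraph k V E}"

lemma indep_cover_exists:
  assumes "kgraph k V E"
  shows "\<exists>I. indep_cover k V E (card (kgraph_complement k V E)) I"
proof -
  let ?C = "kgraph_complement k V E"
  have fin: "finite ?C"
    using assms by (auto simp: kgraph_def kgraph_complement_def finite_imp_finite_nsets)
  obtain I where I: "bij_betw I {1..card ?C} ?C"
    using ex_bij_betw_nat_finite_1[OF fin] by blast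
  have "hindependent V E e" if e: "e \<in> ?C" for e
  proof -
    have "f = e" if "f \<in> E" "f \<subseteq> e" for f
      using that e assms unfolding kgraph_def kgraph_complement_def nsets_def
      by (intro card_subset_eq) auto
    then show ?thesis
      using e by (auto simp: hindependent_def kgraph_complement_def nsets_def)
  qed
  then have "indep_cover k V E (card ?C) I"
    using I unfolding indep_cover_def bij_betw_def by (metis imageE imageI order_refl)
  then show ?thesis by blast
qed

lemma theta_le: "indep_cover k V E t I \<Longrightarrow> theta k V E \<le> t"
  unfolding theta_def by (rule Least_le) blast

lemma theta_attained: "kgraph k V E \<Longrightarrow> \<exists>I. indep_cover k V E (theta k V E) I"
  unfolding theta_def by (rule LeastI) (rule indep_cover_exists)

lemma theta_le_binomial:
  assumes "kgraph k V E"
  shows "theta k V E \<le> card V choose k"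
proof -
  have "theta k V E \<le> card (kgraph_complement k V E)"
    using indep_cover_exists[OF assms] theta_le by blast
  also have "\<dots> \<le> card (nsets V k)"
    using assms
    by (intro card_mono) (auto simp: kgraph_def kgraph_complement_def finite_imp_finite_nsets)
  finally show ?thesis by simp
qed

lemma finite_theta_values:
  "finite {theta k V E | (V :: nat set) E. card V = n \<and> simple_kgraph k V E}"
  by (rule finite_subset[of _ "{..n choose k}"])
    (auto simp: simple_kgraph_def dest: theta_le_binomial)

lemma theta_s_attained:
  "\<exists>(V :: nat set) E. card V = n \<and> simple_kgraph k V E \<and> theta_s n k = theta k V E"
proof -
  let ?S = "{theta k V E | (V :: nat set) E. card V = n \<and> simple_kgraph k V E}"
  have "simple_kgraph k {..<n} {}"
    by (simp add: simple_kgraph_def kgraph_def)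
  then have "theta k {..<n} {} \<in> ?S" by force
  then have "Max ?S \<in> ?S" using finite_theta_values by (intro Max_in) auto
  then show ?thesis unfolding theta_s_def by blast
qed

lemma theta_image:
  assumes "kgraph k V E" and inj: "inj_on f V"
  shows "theta k V E \<le> theta k (f ` V) ((`) f ` E)"
proof -
  let ?E = "(`) f ` E"
  have VE: "\<And>e. e \<in> E \<Longrightarrow> e \<subseteq> V" using assms(1) by (auto simp: kgraph_def nsets_def)
  have mem: "f ` e \<in> nsets (f ` V) k" if "e \<in> nsets V k" for e
    using that inj by (auto simp: nsets_def card_image inj_on_subset)
  have "kgraph k (f ` V) ?E" using assms(1) mem by (auto simp: kgraph_def)
  then obtain I where I: "indep_cover k (f ` V) ?E (theta k (f ` V) ?E) I"
    using theta_attained by blast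
  have "indep_cover k V E (theta k (f ` V) ?E) (\<lambda>j. f -` I j \<inter> V)"
    unfolding indep_cover_def
  proof (intro conjI ballI)
    fix j assume "j \<in> {1..theta k (f ` V) ?E}"
    then have "hindependent (f ` V) ?E (I j)" using I by (simp add: indep_cover_def)
    then show "hindependent V E (f -` I j \<inter> V)"
      by (auto simp: hindependent_def) 
  next
    fix e assume e: "e \<in> kgraph_complement k V E"
    then have eV: "e \<subseteq> V" by (auto simp: kgraph_complement_def nsets_def)
    have "f ` e \<notin> ?E"
      using e VE eV inj_on_image_eq_iff[OF inj] by (auto simp: kgraph_complement_def)
    then have "f ` e \<in> kgraph_complement k (f ` V) ?E"
      using e mem by (auto simp: kgraph_complement_def)
    then obtain j where "j \<in> {1..theta k (f ` V) ?E}" "f ` e \<subseteq> I j"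
      using I unfolding indep_cover_def by blast
    then show "\<exists>j\<in>{1..theta k (f ` V) ?E}. e \<subseteq> f -` I j \<inter> V"
      using eV by blast
  qed
  then show ?thesis by (rule theta_le)
qed

lemma theta_le_theta_s:
  fixes V :: "'a set"
  assumes G: "simple_kgraph k V E"
  shows "theta k V E \<le> theta_s (card V) k"
proof -
  have fin: "finite V" and E: "E \<subseteq> nsets V k" using G by (auto simp: simple_kgraph_def kgraph_def)
  obtain f :: "'a \<Rightarrow> nat" where inj: "inj_on f V"
    using finite_imp_inj_to_nat_seg[OF fin] by blast
  let ?E = "(`) f ` E"
  have VE: "\<And>e. e \<in> E \<Longrightarrow> e \<subseteq> V" using E by (auto simp: nsets_def)
  have "card (f ` e \<inter> f ` e') \<le> 1" if "e \<in> E" "e' \<in> E" "f ` e \<noteq> f ` e'" for e e'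
  proof -
    have "card (f ` e \<inter> f ` e') = card (e \<inter> e')"
      using that VE inj by (metis inj_on_image_Int card_image inj_on_subset inf.coboundedI1)
    then show ?thesis using G that by (auto simp: simple_kgraph_def)
  qed
  moreover have "kgraph k (f ` V) ?E"
    using fin E inj by (fastforce simp: kgraph_def nsets_def card_image inj_on_subset)
  ultimately have "simple_kgraph k (f ` V) ?E"
    by (auto simp: simple_kgraph_def)
  moreover have "card (f ` V) = card V" using inj by (rule card_image)
  ultimately have "theta k (f ` V) ?E \<le> theta_s (card V) k"
    unfolding theta_s_def by (intro Max_ge finite_theta_values) blast
  then show ?thesis
    using theta_image[OF _ inj, of k E] G by (force simp: simple_kgraph_def)
qed

end

theory Submission
  imports Defs "HOL-Real_Asymp.Real_Asymp"
begin

text \<open>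
  Upper bound: colour the vertices at random with \<open>q\<close> colours, where \<open>q\<close> is of order
  \<open>n powr (1 / (k - 1))\<close>, and delete from the first colour class every vertex of an edge lying inside it.
  A non-edge \<open>x\<close> lies in the class with probability \<open>q\<close> to the power \<open>-k\<close>. Given this, at most \<open>k n\<close>
  edges meet \<open>x\<close> once and, by simplicity, at most \<open>k choose 2\<close> edges meet it more often, so with
  probability at least 1/2 no vertex of \<open>x\<close> is deleted. Choosing colourings greedily then covers all
  non-edges.

  Lower bound: a family of \<open>t\<close> independent sets covering the complement determines the edge set. If every
  independent set has at most \<open>s\<close> vertices, there are at most \<open>(n + 1) ^ (s t)\<close> such families, so \<open>t\<close> is
  at least of order \<open>n\<^sup>2 / s\<close> as soon as there are \<open>n\<close> to the power \<open>c n\<^sup>2\<close> simple \<open>k\<close>-graphs without larger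
  independent sets. To find them, scan a random sequence of about \<open>n\<^sup>2\<close> many \<open>k\<close>-sets and accept those
  that keep the graph simple; with positive probability this leaves no independent set of size \<open>s\<close>, for
  \<open>s ^ (k - 1)\<close> of order \<open>n ^ (k - 2) ln n\<close>. The accepted graph still extends to a simple graph in
  sufficiently many ways, because each edge excludes only a proportion \<open>O(1 / n\<^sup>2)\<close> of all \<open>k\<close>-sets.
\<close>

subsection \<open>Counting \<open>k\<close>-sets\<close>

lemma card_nsets_containing:
  assumes "finite S" "T \<subseteq> S" "card T \<le> k"
  shows "card {e \<in> nsets S k. T \<subseteq> e} = (card S - card T) choose (k - card T)"
proof -
  have fT: "finite T" using assms finite_subset by blast
  have "bij_betw (\<lambda>e. e - T) {e \<in> nsets S k. T \<subseteq> e} (nsets (S - T) (k - card T))"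
  proof (rule bij_betwI[where g = "\<lambda>d. d \<union> T"])
    show "(\<lambda>e. e - T) \<in> {e \<in> nsets S k. T \<subseteq> e} \<rightarrow> nsets (S - T) (k - card T)"
      using fT by (auto simp: nsets_def card_Diff_subset)
    show "(\<lambda>d. d \<union> T) \<in> nsets (S - T) (k - card T) \<rightarrow> {e \<in> nsets S k. T \<subseteq> e}"
    proof
      fix d assume d: "d \<in> nsets (S - T) (k - card T)"
      then have "card (d \<union> T) = card d + card T"
        using fT by (intro card_Un_disjoint) (auto simp: nsets_def)
      with d assms fT show "d \<union> T \<in> {e \<in> nsets S k. T \<subseteq> e}"
        by (auto simp: nsets_def)
    qed
  qed (auto simp: nsets_def)
  then have "card {e \<in> nsets S k. T \<subseteq> e} = card (nsets (S - T) (k - card T))"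
    by (rule bij_betw_same_card)
  also have "\<dots> = (card S - card T) choose (k - card T)"
    using assms fT by (simp add: card_Diff_subset)
  finally show ?thesis .
qed

text \<open>Union bound over the pairs inside \<open>S \<inter> T\<close>, each of which lies in the
  same number of \<open>k\<close>-subsets of \<open>S\<close>.\<close>

lemma card_nsets_meeting_twice:
  assumes "finite S" "2 \<le> k"
  shows "card {e \<in> nsets S k. 2 \<le> card (e \<inter> T)} \<le> (card (S \<inter> T) choose 2) * ((card S - 2) choose (k - 2))"
proof -
  let ?P = "nsets (S \<inter> T) 2"
  have "finite ?P" using assms by (simp add: finite_imp_finite_nsets)
  have "{e \<in> nsets S k. 2 \<le> card (e \<inter> T)} \<subseteq> (\<Union>p\<in>?P. {e \<in> nsets S k. p \<subseteq> e})"
  proof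
    fix e assume "e \<in> {e \<in> nsets S k. 2 \<le> card (e \<inter> T)}"
    then have e: "e \<in> nsets S k" "2 \<le> card (e \<inter> T)" by auto
    obtain p where "p \<subseteq> e \<inter> T" "card p = 2" "finite p"
      using obtain_subset_with_card_n[OF e(2)] by metis
    with e show "e \<in> (\<Union>p\<in>?P. {e \<in> nsets S k. p \<subseteq> e})"
      by (auto simp: nsets_def)
  qed
  moreover have "finite (\<Union>p\<in>?P. {e \<in> nsets S k. p \<subseteq> e})"
    using assms \<open>finite ?P\<close> by (auto simp: finite_imp_finite_nsets)
  ultimately have "card {e \<in> nsets S k. 2 \<le> card (e \<inter> T)} \<le> card (\<Union>p\<in>?P. {e \<in> nsets S k. p \<subseteq> e})"
    by (intro card_mono)
  also have "\<dots> \<le> (\<Sum>p\<in>?P. card {e \<in> nsets S k. p \<subseteq> e})"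
    using \<open>finite ?P\<close> by (rule card_UN_le)
  also have "\<dots> = (\<Sum>p\<in>?P. (card S - 2) choose (k - 2))"
  proof (rule sum.cong[OF refl])
    fix p assume "p \<in> ?P"
    then have "p \<subseteq> S" "card p = 2" by (auto simp: nsets_def)
    with assms card_nsets_containing[of S p k]
    show "card {e \<in> nsets S k. p \<subseteq> e} = (card S - 2) choose (k - 2)" by simp
  qed
  also have "\<dots> = (card (S \<inter> T) choose 2) * ((card S - 2) choose (k - 2))"
    by simp
  finally show ?thesis .
qed

text \<open>The absorption identity used twice. The product form needs no division and stays valid
  for \<open>n\<close> below 2.\<close>

lemma choose_minus2:
  assumes "2 \<le> k"
  shows "k * (k - 1) * (n choose k) = n * (n - 1) * ((n - 2) choose (k - 2))"
proof -
  have 1: "k * (n choose k) = n * ((n - 1) choose (k - 1))"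
    using assms by (intro times_binomial_minus1_eq) auto
  have 2: "(k - 1) * ((n - 1) choose (k - 1)) = (n - 1) * ((n - 1 - 1) choose (k - 1 - 1))"
    using assms by (intro times_binomial_minus1_eq) auto
  have "k * (k - 1) * (n choose k) = (k - 1) * (k * (n choose k))" by (simp only: mult_ac)
  also have "\<dots> = n * ((k - 1) * ((n - 1) choose (k - 1)))" by (simp only: 1 mult_ac)
  also have "\<dots> = n * (n - 1) * ((n - 2) choose (k - 2))"
    unfolding 2 by (simp add: numeral_2_eq_2)
  finally show ?thesis .
qed

text \<open>The factor 2 pays for replacing \<open>n - 1\<close> by \<open>n\<close>, which is where
  \<open>2 \<le> n\<close> enters. Read as a proportion, a fixed pair lies in
  \<open>O(k ^ 2 / n ^ 2)\<close> of all \<open>k\<close>-sets; the density estimates of the lower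
  bound rest on this.\<close>

lemma choose_minus2_le:
  assumes "2 \<le> k" "2 \<le> n"
  shows "real n ^ 2 * real ((n - 2) choose (k - 2)) \<le> 2 * real k ^ 2 * real (n choose k)"
proof -
  have eq: "real n * (real n - 1) * real ((n - 2) choose (k - 2)) = real k * (real k - 1) * real (n choose k)"
    using choose_minus2[OF assms(1), of n, THEN arg_cong[of _ _ real]] assms by (simp add: of_nat_diff)
  have "real n ^ 2 * real ((n - 2) choose (k - 2)) \<le> 2 * (real n * (real n - 1)) * real ((n - 2) choose (k - 2))"
    using assms by (intro mult_right_mono) (auto simp: power2_eq_square algebra_simps)
  also have "\<dots> = 2 * (real k * (real k - 1)) * real (n choose k)"
    using eq by simp
  also have "\<dots> \<le> 2 * real k ^ 2 * real (n choose k)"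
    by (intro mult_right_mono) (auto simp: power2_eq_square algebra_simps)
  finally show ?thesis .
qed

lemma choose2_le: "real (k choose 2) \<le> real k ^ 2 / 2"
proof -
  have "2 * (k choose 2) \<le> k * (k - 1)" unfolding choose_two by simp
  also have "\<dots> \<le> k * k" by simp
  finally have "2 * (k choose 2) \<le> k * k" .
  then have "real (2 * (k choose 2)) \<le> real (k * k)" using of_nat_le_iff by blast
  then show ?thesis by (simp add: power2_eq_square)
qed

lemma real_card_Diff:
  assumes "finite B" "A \<subseteq> B"
  shows "real (card (B - A)) = real (card B) - real (card A)"
  using assms card_mono[OF assms] finite_subset[OF assms(2,1)]
  by (simp add: card_Diff_subset of_nat_diff)

subsection \<open>The upper bound\<close>

text \<open>Averaging: each uncovered point lies in \<open>J w\<close> for at least a proportion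
  \<open>d\<close> of all \<open>w\<close>, so some \<open>w\<close> covers at least that proportion
  of the uncovered points.\<close>

lemma greedy_cover:
  fixes J :: "'b \<Rightarrow> 'a set" and d :: real
  assumes "finite X" "finite W" "W \<noteq> {}" "d \<le> 1"
    and often: "\<And>x. x \<in> X \<Longrightarrow> d * real (card W) \<le> real (card {w \<in> W. x \<in> J w})"
  shows "\<exists>f. (\<forall>j\<in>{1..t}. f j \<in> W) \<and> real (card (X - (\<Union>j\<in>{1..t}. J (f j)))) \<le> (1 - d) ^ t * real (card X)"
proof (induction t)
  case 0
  then show ?case by auto
next
  case (Suc t)
  then obtain f where f: "\<forall>j\<in>{1..t}. f j \<in> W"
    "real (card (X - (\<Union>j\<in>{1..t}. J (f j)))) \<le> (1 - d) ^ t * real (card X)" by blast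
  define Y where "Y = X - (\<Union>j\<in>{1..t}. J (f j))"
  have "finite Y" using assms by (simp add: Y_def)
  \<comment> \<open>Otherwise, counting the incidences between \<open>W\<close> and \<open>Y\<close>
    from either side gives contradictory totals.\<close>
  have "\<exists>w\<in>W. d * real (card Y) \<le> real (card (Y \<inter> J w))"
  proof (rule ccontr)
    assume "\<not> ?thesis"
    then have "(\<Sum>w\<in>W. real (card (Y \<inter> J w))) < (\<Sum>w\<in>W. d * real (card Y))"
      using assms by (intro sum_strict_mono) auto
    also have "\<dots> = (\<Sum>x\<in>Y. d * real (card W))" by simp
    also have "\<dots> \<le> (\<Sum>x\<in>Y. real (card {w \<in> W. x \<in> J w}))"
      using often by (intro sum_mono) (auto simp: Y_def)
    also have "\<dots> = (\<Sum>x\<in>Y. \<Sum>w\<in>W. if x \<in> J w then 1 else 0)"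
      using assms by (simp add: sum.If_cases Int_def)
    also have "\<dots> = (\<Sum>w\<in>W. \<Sum>x\<in>Y. if x \<in> J w then 1 else 0)" by (rule sum.swap)
    also have "\<dots> = (\<Sum>w\<in>W. real (card (Y \<inter> J w)))"
      using \<open>finite Y\<close> by (simp add: sum.If_cases)
    finally show False by simp
  qed
  then obtain w where w: "w \<in> W" "d * real (card Y) \<le> real (card (Y \<inter> J w))" by blast
  define g where "g = f(Suc t := w)"
  have un: "(\<Union>j\<in>{1..Suc t}. J (g j)) = (\<Union>j\<in>{1..t}. J (f j)) \<union> J w"
    by (auto simp: g_def atLeastAtMostSuc_conv)
  have "X - (\<Union>j\<in>{1..Suc t}. J (g j)) = Y - (Y \<inter> J w)" unfolding un by (auto simp: Y_def)
  moreover have "real (card (Y - (Y \<inter> J w))) = real (card Y) - real (card (Y \<inter> J w))"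
    using \<open>finite Y\<close> by (intro real_card_Diff) auto
  ultimately have "real (card (X - (\<Union>j\<in>{1..Suc t}. J (g j)))) \<le> (1 - d) * real (card Y)"
    using w by (simp add: algebra_simps)
  also have "\<dots> \<le> (1 - d) * ((1 - d) ^ t * real (card X))"
    using f(2) assms(4) by (intro mult_left_mono) (auto simp: Y_def)
  finally have "real (card (X - (\<Union>j\<in>{1..Suc t}. J (g j)))) \<le> (1 - d) ^ Suc t * real (card X)"
    by (simp add: mult.assoc)
  moreover have "\<forall>j\<in>{1..Suc t}. g j \<in> W" using f w by (auto simp: g_def)
  ultimately show ?case by blast
qed

text \<open>Follows from \<open>1 - d \<le> exp (- d)\<close>. The number of uncovered points is an
  integer, so a bound below 1 means that everything is covered.\<close>

lemma one_minus_power_less: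
  fixes d y :: real
  assumes "0 \<le> d" "d \<le> 1" "0 < y" "ln y < d * real t"
  shows "(1 - d) ^ t * y < 1"
proof -
  have "(1 - d) ^ t \<le> exp (- d) ^ t"
    using assms exp_ge_add_one_self[of "- d"] by (intro power_mono) auto
  also have "\<dots> = exp (- (d * real t))" by (simp add: exp_of_nat_mult[symmetric] mult.commute)
  also have "\<dots> < exp (- ln y)" using assms by simp
  also have "\<dots> = 1 / y" using assms by (simp add: exp_minus inverse_eq_divide)
  finally show ?thesis using assms by (simp add: field_simps)
qed

section \<open>Random colourings and local counts in simple graphs\<close>

lemma card_colourings:
  assumes "finite V" "S \<subseteq> V" "0 < q"
  shows "card {c \<in> V \<rightarrow>\<^sub>E {..<q}. \<forall>v\<in>S. c v = 0} * q ^ card S = q ^ card V"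
proof -
  have "{c \<in> V \<rightarrow>\<^sub>E {..<q}. \<forall>v\<in>S. c v = 0} = PiE V (\<lambda>v. if v \<in> S then {0} else {..<q})"
  proof (intro set_eqI iffI)
    fix c assume "c \<in> {c \<in> V \<rightarrow>\<^sub>E {..<q}. \<forall>v\<in>S. c v = 0}"
    then show "c \<in> PiE V (\<lambda>v. if v \<in> S then {0} else {..<q})"
      by (auto simp: PiE_iff)
  next
    fix c assume c: "c \<in> PiE V (\<lambda>v. if v \<in> S then {0} else {..<q})"
    have "c v = 0" if "v \<in> S" for v
      using PiE_mem[OF c, of v] that assms by auto
    moreover have "c v < q" if "v \<in> V" for v
      using PiE_mem[OF c, of v] that assms by (auto split: if_splits)
    ultimately show "c \<in> {c \<in> V \<rightarrow>\<^sub>E {..<q}. \<forall>v\<in>S. c v = 0}"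
      using c by (auto simp: PiE_def)
  qed
  then have "card {c \<in> V \<rightarrow>\<^sub>E {..<q}. \<forall>v\<in>S. c v = 0} = (\<Prod>v\<in>V. if v \<in> S then 1 else q)"
    using assms by (simp add: card_PiE if_distrib cong: if_cong)
  also have "\<dots> = q ^ card (V - S)"
    using assms by (simp add: prod.If_cases Diff_eq)
  finally show ?thesis
    using assms by (simp add: card_Diff_subset finite_subset card_mono flip: power_add)
qed

lemma simple_kgraph_pair:
  assumes "simple_kgraph k V E" "e \<in> E" "f \<in> E" "{u, v} \<subseteq> e" "{u, v} \<subseteq> f" "u \<noteq> v"
  shows "e = f"
proof (rule ccontr)
  assume "e \<noteq> f"
  then have "card (e \<inter> f) \<le> 1" using assms by (auto simp: simple_kgraph_def)
  moreover have "card {u, v} \<le> card (e \<inter> f)"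
    using assms by (intro card_mono) (auto simp: simple_kgraph_def kgraph_def nsets_def)
  ultimately show False using assms by simp
qed

text \<open>Sending each edge at \<open>v\<close> to another of its vertices is injective, because
  two edges through \<open>v\<close> share nothing else.\<close>

lemma simple_kgraph_degree:
  assumes G: "simple_kgraph k V E" and k: "2 \<le> k"
  shows "card {f \<in> E. v \<in> f} \<le> card V"
proof -
  have "\<exists>u. u \<in> f \<and> u \<noteq> v" if "f \<in> E" for f
  proof -
    have "card f = k" using that G by (auto simp: simple_kgraph_def kgraph_def nsets_def)
    then have "\<not> f \<subseteq> {v}" using k card_mono[of "{v}" f] by auto
    then show ?thesis by blast
  qed
  then obtain w where w: "\<And>f. f \<in> E \<Longrightarrow> w f \<in> f \<and> w f \<noteq> v" by metis
  have "inj_on w {f \<in> E. v \<in> f}"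
  proof (rule inj_onI)
    fix e f assume "e \<in> {f \<in> E. v \<in> f}" "f \<in> {f \<in> E. v \<in> f}" "w e = w f"
    then show "e = f" using w[of e] w[of f] simple_kgraph_pair[OF G, of e f v "w e"] by auto
  qed
  moreover have "w ` {f \<in> E. v \<in> f} \<subseteq> V"
    using w G by (fastforce simp: simple_kgraph_def kgraph_def nsets_def)
  ultimately show ?thesis
    using G by (intro card_inj_on_le) (auto simp: simple_kgraph_def kgraph_def)
qed

text \<open>Each such edge contains a pair of vertices of \<open>e\<close>, and in a simple graph a
  pair determines its edge.\<close>

lemma simple_kgraph_meeting_twice:
  assumes G: "simple_kgraph k V E" and e: "finite e"
  shows "card {f \<in> E. 2 \<le> card (f \<inter> e)} \<le> card e choose 2"
proof -
  have "\<exists>p. p \<in> nsets e 2 \<and> p \<subseteq> f" if f: "2 \<le> card (f \<inter> e)" for f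
    using obtain_subset_with_card_n[OF f] by (force simp: nsets_def)
  then obtain p where p: "\<And>f. 2 \<le> card (f \<inter> e) \<Longrightarrow> p f \<in> nsets e 2 \<and> p f \<subseteq> f" by metis
  have "inj_on p {f \<in> E. 2 \<le> card (f \<inter> e)}"
  proof (rule inj_onI)
    fix f g assume fg: "f \<in> {f \<in> E. 2 \<le> card (f \<inter> e)}" "g \<in> {f \<in> E. 2 \<le> card (f \<inter> e)}" "p f = p g"
    then have "card (p f) = 2" using p[of f] by (auto simp: nsets_def)
    then obtain u v where "p f = {u, v}" "u \<noteq> v" by (meson card_2_iff)
    with fg show "f = g" using p[of f] p[of g] simple_kgraph_pair[OF G, of f g u v] by auto
  qed
  then have "card {f \<in> E. 2 \<le> card (f \<inter> e)} \<le> card (nsets e 2)"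
    using p e by (intro card_inj_on_le[of p]) (auto simp: finite_imp_finite_nsets)
  then show ?thesis by simp
qed

definition surviving :: "'a set \<Rightarrow> 'a set set \<Rightarrow> ('a \<Rightarrow> nat) \<Rightarrow> 'a set" where
  "surviving V E c = {v \<in> V. c v = 0 \<and> (\<forall>f\<in>E. v \<in> f \<longrightarrow> (\<exists>u\<in>f. c u \<noteq> 0))}"

text \<open>An edge of surviving vertices would have colour 0 throughout, which is exactly the
  reason to delete its vertices; \<open>0 < k\<close> supplies one of them.\<close>

lemma hindependent_surviving:
  assumes "kgraph k V E" "0 < k"
  shows "hindependent V E (surviving V E c)"
  unfolding hindependent_def
proof (intro conjI ballI notI)
  fix f assume f: "f \<in> E" "f \<subseteq> surviving V E c"
  then have "f \<noteq> {}" using assms by (auto simp: kgraph_def nsets_def)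
  then obtain v where "v \<in> f" by blast
  with f obtain u where "u \<in> f" "c u \<noteq> 0" by (auto simp: surviving_def)
  with f show False by (auto simp: surviving_def)
qed (auto simp: surviving_def)

text \<open>Given that \<open>x\<close> has colour 0, only an edge \<open>f\<close> meeting
  \<open>x\<close> can delete a vertex of \<open>x\<close>, and only if all of
  \<open>x \<union> f\<close> has colour 0. By the two hypotheses on \<open>q\<close>, edges meeting
  \<open>x\<close> once spoil at most 1/4 of these colourings and the other edges at most
  1/8.\<close>

lemma card_surviving_ge:
  fixes V :: "'a set" and q k :: nat
  assumes G: "simple_kgraph k V E" and k: "2 \<le> k"
    and q: "4 * k * card V \<le> q ^ (k - 1)" "4 * k ^ 2 \<le> q"
    and x: "x \<in> kgraph_complement k V E"
  shows "1 / (2 * real q ^ k) * real (card (V \<rightarrow>\<^sub>E {..<q}))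
    \<le> real (card {c \<in> V \<rightarrow>\<^sub>E {..<q}. x \<subseteq> surviving V E c})"
proof -
  define Z where "Z S = {c \<in> V \<rightarrow>\<^sub>E {..<q}. \<forall>v\<in>S. c v = 0}" for S
  \<comment> \<open>The number of colourings that are 0 on the \<open>k\<close> vertices of
    \<open>x\<close>.\<close>
  define N where "N = real q ^ card V / real q ^ k"
  have q0: "0 < q" using q(2) k by (cases q) auto
  have fV: "finite V" and EV: "\<And>f. f \<in> E \<Longrightarrow> f \<subseteq> V \<and> finite f \<and> card f = k"
    using G by (auto simp: simple_kgraph_def kgraph_def nsets_def)
  have finE: "finite E"
    using G fV by (auto simp: simple_kgraph_def kgraph_def intro: finite_subset finite_imp_finite_nsets)
  have xV: "x \<subseteq> V" "finite x" "card x = k" "x \<notin> E"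
    using x by (auto simp: kgraph_complement_def nsets_def)
  have Z: "real (card (Z S)) = real q ^ card V / real q ^ card S" if "S \<subseteq> V" for S
    using card_colourings[OF fV that q0, THEN arg_cong[of _ _ real]] q0
    unfolding Z_def by (simp add: field_simps)
  have finW: "finite (V \<rightarrow>\<^sub>E {..<q})" using fV by (intro finite_PiE) auto
  then have finZ: "finite (Z S)" for S by (simp add: Z_def)
  have N0: "0 \<le> N" by (simp add: N_def)
  define E1 where "E1 = {f \<in> E. card (f \<inter> x) = 1}"
  define E2 where "E2 = {f \<in> E. 2 \<le> card (f \<inter> x)}"
  have fin12: "finite E1" "finite E2" using finE by (auto simp: E1_def E2_def)
  have card_un: "card (x \<union> f) + card (f \<inter> x) = 2 * k" if "f \<in> E" for f
    using card_Un_Int[of x f] that EV xV by (simp add: Int_commute)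
  have E1Z: "real (card (Z (x \<union> f))) = N / real q ^ (k - 1)" if "f \<in> E1" for f
  proof -
    have f: "f \<in> E" "card (f \<inter> x) = 1" using that by (auto simp: E1_def)
    then have "card (x \<union> f) = k + (k - 1)" using card_un[of f] k by simp
    with f show ?thesis using Z[of "x \<union> f"] EV xV by (simp add: N_def power_add)
  qed
  \<comment> \<open>As \<open>x\<close> is not an edge, \<open>f\<close> differs from it, so
    \<open>x \<union> f\<close> has at least \<open>k + 1\<close> vertices. Gaining a single factor
    \<open>1 / q\<close> is enough because \<open>E2\<close> has bounded size.\<close>
  have E2Z: "real (card (Z (x \<union> f))) \<le> N / real q" if "f \<in> E2" for f
  proof -
    have f: "f \<in> E" using that by (auto simp: E2_def)
    have "\<not> x \<subseteq> f" using f xV EV[of f] card_subset_eq[of f x] by auto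
    have "x \<noteq> f" using f xV by auto
    then have "f \<inter> x \<noteq> f" using f xV EV[of f] card_subset_eq[of x f] by auto
    then have "card (f \<inter> x) < k" using EV[OF f] psubset_card_mono[of f "f \<inter> x"] by auto
    then have "Suc k \<le> card (x \<union> f)" using card_un[OF f] by simp
    then have "real q ^ Suc k \<le> real q ^ card (x \<union> f)"
      using q0 by (intro power_increasing) auto
    then have "real q ^ card V / real q ^ card (x \<union> f) \<le> real q ^ card V / real q ^ Suc k"
      using q0 by (intro divide_left_mono) auto
    then show ?thesis using Z[of "x \<union> f"] EV[OF f] xV by (simp add: N_def mult.commute)
  qed
  have "E1 \<subseteq> (\<Union>v\<in>x. {f \<in> E. v \<in> f})"
  proof
    fix f assume f: "f \<in> E1"
    then have "f \<inter> x \<noteq> {}" by (auto simp: E1_def)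
    with f show "f \<in> (\<Union>v\<in>x. {f \<in> E. v \<in> f})" by (auto simp: E1_def)
  qed
  then have "card E1 \<le> card (\<Union>v\<in>x. {f \<in> E. v \<in> f})"
    using finE xV by (intro card_mono) auto
  also have "\<dots> \<le> (\<Sum>v\<in>x. card {f \<in> E. v \<in> f})" using xV by (intro card_UN_le)
  also have "\<dots> \<le> (\<Sum>v\<in>x. card V)" by (intro sum_mono simple_kgraph_degree[OF G k])
  finally have cE1: "card E1 \<le> k * card V" using xV by simp
  have cE2: "card E2 \<le> k choose 2"
    using simple_kgraph_meeting_twice[OF G xV(2)] xV unfolding E2_def by simp
  have "Z x - (\<Union>f\<in>E1 \<union> E2. Z (x \<union> f)) \<subseteq> {c \<in> V \<rightarrow>\<^sub>E {..<q}. x \<subseteq> surviving V E c}"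
  proof
    fix c assume c: "c \<in> Z x - (\<Union>f\<in>E1 \<union> E2. Z (x \<union> f))"
    have "\<exists>u\<in>f. c u \<noteq> 0" if "f \<in> E" "v \<in> f" "v \<in> x" for f v
    proof -
      have "card (f \<inter> x) \<noteq> 0" using that EV[of f] by auto
      then have "f \<in> E1 \<union> E2" using that by (auto simp: E1_def E2_def)
      then show ?thesis using c by (auto simp: Z_def)
    qed
    then show "c \<in> {c \<in> V \<rightarrow>\<^sub>E {..<q}. x \<subseteq> surviving V E c}"
      using c xV by (auto simp: Z_def surviving_def)
  qed
  then have "card (Z x - (\<Union>f\<in>E1 \<union> E2. Z (x \<union> f))) \<le> card {c \<in> V \<rightarrow>\<^sub>E {..<q}. x \<subseteq> surviving V E c}"
    using finW by (intro card_mono) auto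
  moreover have "card (Z x) - card (\<Union>f\<in>E1 \<union> E2. Z (x \<union> f)) \<le> card (Z x - (\<Union>f\<in>E1 \<union> E2. Z (x \<union> f)))"
    using fin12 finZ by (intro diff_card_le_card_Diff) auto
  moreover have "card (\<Union>f\<in>E1 \<union> E2. Z (x \<union> f)) \<le> (\<Sum>f\<in>E1 \<union> E2. card (Z (x \<union> f)))"
    using fin12 by (intro card_UN_le) auto
  moreover have "(\<Sum>f\<in>E1 \<union> E2. card (Z (x \<union> f))) = (\<Sum>f\<in>E1. card (Z (x \<union> f))) + (\<Sum>f\<in>E2. card (Z (x \<union> f)))"
    using fin12 by (intro sum.union_disjoint) (auto simp: E1_def E2_def)
  ultimately have "card (Z x) \<le> card {c \<in> V \<rightarrow>\<^sub>E {..<q}. x \<subseteq> surviving V E c}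
      + (\<Sum>f\<in>E1. card (Z (x \<union> f))) + (\<Sum>f\<in>E2. card (Z (x \<union> f)))"
    by linarith
  then have main: "real (card (Z x)) \<le> real (card {c \<in> V \<rightarrow>\<^sub>E {..<q}. x \<subseteq> surviving V E c})
      + (\<Sum>f\<in>E1. real (card (Z (x \<union> f)))) + (\<Sum>f\<in>E2. real (card (Z (x \<union> f))))"
    by (simp flip: of_nat_sum of_nat_add)
  have "(\<Sum>f\<in>E1. real (card (Z (x \<union> f)))) = real (card E1) * (N / real q ^ (k - 1))"
    using E1Z by simp
  also have "\<dots> \<le> real (k * card V) * (N / real q ^ (k - 1))"
    using cE1 N0 of_nat_le_iff by (intro mult_right_mono) (auto simp del: of_nat_mult)
  also have "\<dots> = (real (4 * k * card V) / real q ^ (k - 1)) * (N / 4)" by simp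
  also have "\<dots> \<le> 1 * (N / 4)"
  proof (rule mult_right_mono)
    have "real (4 * k * card V) \<le> real (q ^ (k - 1))" using q(1) of_nat_le_iff by blast
    then show "real (4 * k * card V) / real q ^ (k - 1) \<le> 1"
      using q0 by (simp add: divide_le_eq)
  qed (use N0 in auto)
  finally have s1: "(\<Sum>f\<in>E1. real (card (Z (x \<union> f)))) \<le> N / 4" by simp
  have "(\<Sum>f\<in>E2. real (card (Z (x \<union> f)))) \<le> (\<Sum>f\<in>E2. N / real q)"
    using E2Z by (rule sum_mono)
  also have "\<dots> = real (card E2) * (N / real q)" by simp
  also have "\<dots> \<le> real (k choose 2) * (N / real q)"
    using cE2 N0 by (intro mult_right_mono) auto
  also have "\<dots> \<le> real k ^ 2 / 2 * (N / real q)"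
    using choose2_le N0 by (intro mult_right_mono) auto
  also have "\<dots> = (real (4 * k ^ 2) / real q) * (N / 8)" by simp
  also have "\<dots> \<le> 1 * (N / 8)"
  proof (rule mult_right_mono)
    have "real (4 * k ^ 2) \<le> real q" using q(2) of_nat_le_iff by blast
    then show "real (4 * k ^ 2) / real q \<le> 1" using q0 by (simp add: divide_le_eq)
  qed (use N0 in auto)
  finally have s2: "(\<Sum>f\<in>E2. real (card (Z (x \<union> f)))) \<le> N / 8" by simp
  have "real (card (Z x)) = N" using Z[OF xV(1)] xV by (simp add: N_def)
  moreover have "real (card (V \<rightarrow>\<^sub>E {..<q})) = real q ^ card V"
    using fV by (simp add: card_funcsetE)
  ultimately show ?thesis using main s1 s2 N0 unfolding N_def by simp
qed

text \<open>The greedy cover is applied to colourings, at rate \<open>1 / (2 * q ^ k)\<close>. There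
  are at most \<open>card V ^ k\<close> non-edges, so this \<open>t\<close> leaves fewer than one of
  them uncovered.\<close>

lemma theta_le_of_colours:
  fixes V :: "'a set" and q k t :: nat
  assumes G: "simple_kgraph k V E" and k: "2 \<le> k" and V: "0 < card V"
    and q: "4 * k * card V \<le> q ^ (k - 1)" "4 * k ^ 2 \<le> q"
    and t: "2 * real q ^ k * real k * ln (real (card V)) < real t"
  shows "theta k V E \<le> t"
proof -
  let ?W = "V \<rightarrow>\<^sub>E {..<q}" and ?X = "kgraph_complement k V E"
  let ?J = "\<lambda>c. {x. x \<subseteq> surviving V E c}"
  define d where "d = 1 / (2 * real q ^ k)"
  have KG: "kgraph k V E" and fV: "finite V" using G by (auto simp: simple_kgraph_def kgraph_def)
  have q0: "0 < q" using q(2) k by (cases q) auto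
  have finX: "finite ?X" using fV by (simp add: kgraph_complement_def finite_imp_finite_nsets)
  have "1 \<le> real q ^ k" using q0 by (intro one_le_power) simp
  then have d: "0 < d" "d \<le> 1" using q0 unfolding d_def by (simp, subst divide_le_eq_1_pos) linarith+
  have "?W \<noteq> {}" using q0 by (auto simp: PiE_eq_empty_iff)
  moreover have "finite ?W" using fV by (intro finite_PiE) auto
  ultimately obtain f where f: "\<forall>j\<in>{1..t}. f j \<in> ?W"
    "real (card (?X - (\<Union>j\<in>{1..t}. ?J (f j)))) \<le> (1 - d) ^ t * real (card ?X)"
    using greedy_cover[of ?X ?W d ?J t] finX d card_surviving_ge[OF G k q] unfolding d_def by auto
  have "card ?X \<le> card (nsets V k)"
    using fV by (intro card_mono) (auto simp: kgraph_complement_def finite_imp_finite_nsets)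
  also have "\<dots> = card V choose k" by simp
  also have "\<dots> \<le> card V ^ k"
    by (cases "k \<le> card V") (auto simp: binomial_le_pow binomial_eq_0)
  finally have "real (card ?X) \<le> real (card V) ^ k"
    by (metis of_nat_le_iff of_nat_power)
  then have "(1 - d) ^ t * real (card ?X) \<le> (1 - d) ^ t * real (card V) ^ k"
    using d by (intro mult_left_mono) auto
  also have "\<dots> < 1"
  proof (rule one_minus_power_less)
    show "ln (real (card V) ^ k) < d * real t"
      using t V q0 by (simp add: d_def ln_realpow field_simps)
  qed (use d V in auto)
  finally have "card (?X - (\<Union>j\<in>{1..t}. ?J (f j))) = 0" using f(2) by linarith
  then have "?X \<subseteq> (\<Union>j\<in>{1..t}. ?J (f j))" using finX by simp
  then have "indep_cover k V E t (\<lambda>j. surviving V E (f j))"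
    unfolding indep_cover_def using hindependent_surviving[OF KG] k by (intro conjI ballI) (simp, blast)
  then show ?thesis by (rule theta_le)
qed

text \<open>The least \<open>q\<close> with \<open>4 * k * n \<le> q ^ (k - 1)\<close> makes
  \<open>q ^ k\<close> of order \<open>n powr (k / (k - 1))\<close>; the logarithm is the price of
  the greedy cover.\<close>

lemma theta_s_upper:
  fixes k :: nat
  assumes k: "3 \<le> k"
  shows "\<exists>(n0::nat) (c::real). 0 < c \<and>
    (\<forall>n\<ge>n0. real (theta_s n k) \<le> c * real n powr (real k / (real k - 1)) * ln (real n))"
proof -
  define a where "a = 1 / (real k - 1)"
  \<comment> \<open>The 3 absorbs the rounding of \<open>t\<close>, the power of 2 comes from
    \<open>q \<le> 2 * r\<close>, and the last factor from \<open>r ^ k\<close>.\<close>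
  define c where "c = 3 * real k * 2 ^ k * (4 * real k) powr (real k * a)"
  have a: "0 < a" "a * real (k - 1) = 1" using k by (auto simp: a_def of_nat_diff)
  \<comment> \<open>In the threshold, the power ensures \<open>4 * k ^ 2 \<le> r\<close>, and the 3
    ensures \<open>1 \<le> ln n\<close>.\<close>
  have "real (theta_s n k) \<le> c * real n powr (real k / (real k - 1)) * ln (real n)"
    if n: "(4 * k ^ 2) ^ (k - 1) + 3 \<le> n" for n :: nat
  proof -
    have n3: "3 \<le> n" using n by simp
    define r where "r = (4 * real k * real n) powr a"
    define q where "q = nat \<lceil>r\<rceil>"
    define t where "t = nat \<lfloor>2 * real q ^ k * real k * ln (real n)\<rfloor> + 1"
    have r0: "0 < r" using k n3 by (simp add: r_def)
    have r_pow: "r ^ (k - 1) = 4 * real k * real n"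
      using k n3 r0 a by (simp add: r_def powr_powr flip: powr_realpow)
    have r_pow_k: "r ^ k = (4 * real k) powr (real k * a) * real n powr (real k * a)"
      using k n3 r0 by (simp add: r_def powr_powr powr_mult mult.commute flip: powr_realpow)
    have "(4 * real k ^ 2) ^ (k - 1) = real ((4 * k ^ 2) ^ (k - 1))" by simp
    also have "\<dots> \<le> real n" using n by linarith
    also have "\<dots> \<le> r ^ (k - 1)" unfolding r_pow using k n3 by simp
    finally have "(4 * real k ^ 2) ^ (k - 1) \<le> r ^ (k - 1)" .
    then have rk: "4 * real k ^ 2 \<le> r"
      using r0 k power_mono_iff[of "4 * real k ^ 2" r "k - 1"] by simp
    have q: "r \<le> real q" "real q \<le> r + 1" using r0 by (auto simp: q_def)
    have "1 \<le> real k ^ 2" using k by simp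
    then have "1 \<le> r" using rk by linarith
    then have q2: "real q \<le> 2 * r" using q by linarith
    have "real (4 * k * n) \<le> real (q ^ (k - 1))"
      using r_pow power_mono[OF q(1), of "k - 1"] r0 by simp
    then have q_pow: "4 * k * n \<le> q ^ (k - 1)" using of_nat_le_iff by blast
    have "real (4 * k ^ 2) \<le> real q" using rk q by simp
    then have q_ge: "4 * k ^ 2 \<le> q" using of_nat_le_iff by blast
    have ln1: "1 \<le> ln (real n)"
      using n3 exp_le by (subst ln_ge_iff) auto
    have t1: "2 * real q ^ k * real k * ln (real n) < real t"
      unfolding t_def by linarith
    have "1 \<le> real q ^ k * real k * ln (real n)"
      using \<open>1 \<le> r\<close> q k ln1 by (intro mult_ge1_I one_le_power) auto
    moreover have "0 \<le> 2 * real q ^ k * real k * ln (real n)" using ln1 by simp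
    ultimately have "real t \<le> 3 * (real q ^ k * real k * ln (real n))"
      unfolding t_def by linarith
    also have "\<dots> \<le> 3 * ((2 * r) ^ k * real k * ln (real n))"
      using q2 ln1 by (intro mult_left_mono mult_right_mono power_mono) auto
    also have "\<dots> = c * real n powr (real k / (real k - 1)) * ln (real n)"
      by (simp add: c_def power_mult_distrib r_pow_k) (simp add: a_def)
    finally have t2: "real t \<le> c * real n powr (real k / (real k - 1)) * ln (real n)" .
    obtain V :: "nat set" and E where V: "card V = n" "simple_kgraph k V E" "theta_s n k = theta k V E"
      using theta_s_attained by blast
    have "theta_s n k \<le> t"
      using theta_le_of_colours[OF V(2), of q t] V k n3 q_pow q_ge t1 by simp
    then show ?thesis using t2 by linarith
  qed
  moreover have "0 < c" using k by (simp add: c_def)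
  ultimately show ?thesis by blast
qed

subsection \<open>Simple \<open>k\<close>-graphs with small independence number\<close>

text \<open>The head of the list is the set drawn last.\<close>

fun accepted :: "'a set list \<Rightarrow> 'a set set" where
  "accepted [] = {}"
| "accepted (e # es) =
    (if \<forall>f\<in>accepted es. card (e \<inter> f) \<le> 1 then insert e (accepted es) else accepted es)"

lemma accepted_subset: "accepted es \<subseteq> set es"
  by (induction es) auto

lemma finite_accepted [simp]: "finite (accepted es)"
  using accepted_subset finite_subset by blast

lemma card_accepted_le: "card (accepted es) \<le> length es"
  by (induction es) (auto simp: card_insert_if)

lemma simple_kgraph_accepted:
  assumes "finite V" "set es \<subseteq> nsets V k"
  shows "simple_kgraph k V (accepted es)"
  using assms(2)
proof (induction es)
  case Nil
  then show ?case using assms(1) by (simp add: simple_kgraph_def kgraph_def)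
next
  case (Cons e es)
  then show ?case by (auto simp: simple_kgraph_def kgraph_def Int_commute)
qed

text \<open>All draws count, with repetition and whether accepted or not. Acceptance depends on the
  history, but the draws are independent, so a moment bound applies.\<close>

definition hits :: "'a set \<Rightarrow> 'a set list \<Rightarrow> nat" where
  "hits S es = length (filter (\<lambda>e. 2 \<le> card (e \<inter> S)) es)"

lemma card_accepted_meeting_twice:
  "card {f \<in> accepted es. 2 \<le> card (f \<inter> S)} \<le> hits S es"
proof -
  have "{f \<in> accepted es. 2 \<le> card (f \<inter> S)} \<subseteq> set (filter (\<lambda>e. 2 \<le> card (e \<inter> S)) es)"
    using accepted_subset by fastforce
  then have "card {f \<in> accepted es. 2 \<le> card (f \<inter> S)} \<le> card (set (filter (\<lambda>e. 2 \<le> card (e \<inter> S)) es))"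
    by (intro card_mono) auto
  also have "\<dots> \<le> hits S es" unfolding hits_def by (rule card_length)
  finally show ?thesis .
qed

text \<open>The bound on the hits guarantees that, at every step, at least half of all \<open>k\<close>-subsets of \<open>S\<close> would
  be accepted (\<open>card_available_ge\<close>), so that \<open>S\<close> is unlikely to stay independent.\<close>

definition avoiding :: "'a set \<Rightarrow> nat \<Rightarrow> 'a set \<Rightarrow> real \<Rightarrow> nat \<Rightarrow> 'a set list set" where
  "avoiding V k S h m = {es. set es \<subseteq> nsets V k \<and> length es = m \<and> real (hits S es) \<le> h
     \<and> (\<forall>f\<in>accepted es. \<not> f \<subseteq> S)}"

lemma finite_avoiding:
  assumes "finite V"
  shows "finite (avoiding V k S h m)"
  using assms finite_lists_length_eq[of "nsets V k" m]
  by (auto simp: avoiding_def finite_imp_finite_nsets elim!: rev_finite_subset)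

text \<open>A \<open>k\<close>-subset of \<open>S\<close> is blocked only by some \<open>f\<close>
  meeting \<open>S\<close> at least twice. Each such \<open>f\<close> blocks a proportion of at most
  \<open>k ^ 4 / card S ^ 2\<close>, so \<open>h\<close> of them block at most half. Used both for
  the random process and, with \<open>S\<close> the whole vertex set, for counting
  extensions.\<close>

lemma card_available_ge:
  fixes h :: real
  assumes k: "2 \<le> k" and S: "finite S" "2 \<le> card S"
    and h: "2 * real k ^ 4 * h \<le> real (card S) ^ 2"
    and F: "finite F" "real (card {f \<in> F. 2 \<le> card (f \<inter> S)}) \<le> h"
    and Fk: "\<And>f. f \<in> F \<Longrightarrow> finite f \<and> card f = k"
  shows "real (card S choose k) / 2 \<le> real (card {e \<in> nsets S k. \<forall>f\<in>F. card (e \<inter> f) \<le> 1})"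
proof -
  let ?s = "card S" and ?A = "{e \<in> nsets S k. \<forall>f\<in>F. card (e \<inter> f) \<le> 1}"
  let ?F = "{f \<in> F. 2 \<le> card (f \<inter> S)}" and ?B = "\<lambda>f. {e \<in> nsets S k. 2 \<le> card (e \<inter> f)}"
  have fin: "finite (nsets S k)" using S by (simp add: finite_imp_finite_nsets)
  have "nsets S k - ?A \<subseteq> (\<Union>f\<in>?F. ?B f)"
  proof
    fix e assume e: "e \<in> nsets S k - ?A"
    then obtain f where f: "f \<in> F" "2 \<le> card (e \<inter> f)" by force
    have "e \<inter> f \<subseteq> f \<inter> S" using e by (auto simp: nsets_def)
    then have "card (e \<inter> f) \<le> card (f \<inter> S)" using S by (intro card_mono) auto
    then show "e \<in> (\<Union>f\<in>?F. ?B f)" using e f by auto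
  qed
  then have "card (nsets S k - ?A) \<le> card (\<Union>f\<in>?F. ?B f)"
    using fin F by (intro card_mono) auto
  also have "\<dots> \<le> (\<Sum>f\<in>?F. card (?B f))" using F by (intro card_UN_le) auto
  also have "\<dots> \<le> (\<Sum>f\<in>?F. (k choose 2) * ((?s - 2) choose (k - 2)))"
  proof (rule sum_mono)
    fix f assume "f \<in> ?F"
    then have "card (S \<inter> f) \<le> k" using Fk[of f] card_mono[of f "S \<inter> f"] by auto
    then have "card (S \<inter> f) choose 2 \<le> k choose 2" by (rule binomial_right_mono)
    with card_nsets_meeting_twice[OF S(1) k, of f]
    show "card (?B f) \<le> (k choose 2) * ((?s - 2) choose (k - 2))"
      by (meson le_trans mult_le_mono1)
  qed
  also have "\<dots> = card ?F * ((k choose 2) * ((?s - 2) choose (k - 2)))" by simp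
  finally have "real (card (nsets S k - ?A)) \<le> real (card ?F * ((k choose 2) * ((?s - 2) choose (k - 2))))"
    using of_nat_le_iff by blast
  also have "\<dots> = real (card ?F) * (real (k choose 2) * real ((?s - 2) choose (k - 2)))" by simp
  also have "\<dots> \<le> h * (real k ^ 2 / 2 * real ((?s - 2) choose (k - 2)))"
    using F choose2_le by (intro mult_mono mult_right_mono) (auto intro: order_trans[of 0 "real (card ?F)"])
  also have "\<dots> \<le> real (?s choose k) / 2"
  proof -
    have "0 < real ?s" using S(2) by linarith
    then have s: "0 < real ?s ^ 2" by (rule zero_less_power)
    have h0: "0 \<le> h" using F(2) by linarith
    have "real ?s ^ 2 * (h * (real k ^ 2 / 2 * real ((?s - 2) choose (k - 2))))
        = h * (real k ^ 2 / 2) * (real ?s ^ 2 * real ((?s - 2) choose (k - 2)))" by simp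
    also have "\<dots> \<le> h * (real k ^ 2 / 2) * (2 * real k ^ 2 * real (?s choose k))"
      using choose_minus2_le[OF k S(2)] h0 by (intro mult_left_mono) auto
    also have "\<dots> = (2 * real k ^ 4 * h) * (real (?s choose k) / 2)"
      by (simp add: power2_eq_square power4_eq_xxxx)
    also have "\<dots> \<le> real ?s ^ 2 * (real (?s choose k) / 2)"
      using h by (intro mult_right_mono) auto
    finally show ?thesis using s by (simp only: mult_le_cancel_left_pos)
  qed
  finally have "real (card (nsets S k - ?A)) \<le> real (?s choose k) / 2" .
  moreover have "real (card (nsets S k - ?A)) = real (card (nsets S k)) - real (card ?A)"
    using fin by (intro real_card_Diff) auto
  ultimately show ?thesis by simp
qed

text \<open>Whatever the earlier draws in an avoiding list were, at least half of the
  \<open>k\<close>-subsets of \<open>S\<close> are forbidden for the next draw.\<close>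

lemma card_avoiding_le:
  fixes h :: real
  assumes k: "2 \<le> k" and V: "finite V" "S \<subseteq> V" "2 \<le> card S"
    and h: "2 * real k ^ 4 * h \<le> real (card S) ^ 2"
  shows "real (card (avoiding V k S h m)) \<le> (real (card V choose k) - real (card S choose k) / 2) ^ m"
proof (induction m)
  case 0
  have "avoiding V k S h 0 \<subseteq> {[]}" by (auto simp: avoiding_def)
  then have "card (avoiding V k S h 0) \<le> card {[] :: 'a set list}" by (rule card_mono[rotated]) simp
  then show ?case by simp
next
  case (Suc m)
  let ?X = "nsets V k" and ?a = "real (card V choose k) - real (card S choose k) / 2"
  let ?A = "\<lambda>es. {e \<in> nsets S k. \<forall>f\<in>accepted es. card (e \<inter> f) \<le> 1}"
  have fS: "finite S" using V finite_subset by blast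
  have finX: "finite ?X" using V by (simp add: finite_imp_finite_nsets)
  \<comment> \<open>Dropping the last draw keeps the list avoiding, since hits only grow along the
    list. The last draw is not a compatible subset of \<open>S\<close>, for that would have been
    accepted.\<close>
  have "avoiding V k S h (Suc m) \<subseteq> (\<lambda>(es, e). e # es) ` (SIGMA es:avoiding V k S h m. ?X - ?A es)"
  proof
    fix l assume l: "l \<in> avoiding V k S h (Suc m)"
    then obtain e es where [simp]: "l = e # es" by (cases l) (auto simp: avoiding_def)
    have "real (hits S es) \<le> real (hits S l)" by (simp add: hits_def)
    then have "es \<in> avoiding V k S h m"
      using l by (auto simp: avoiding_def split: if_splits)
    moreover have "e \<in> ?X - ?A es"
      using l by (auto simp: avoiding_def nsets_def split: if_splits)
    ultimately show "l \<in> (\<lambda>(es, e). e # es) ` (SIGMA es:avoiding V k S h m. ?X - ?A es)"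
      by (intro image_eqI[of _ _ "(es, e)"]) auto
  qed
  then have "card (avoiding V k S h (Suc m))
      \<le> card ((\<lambda>(es, e). e # es) ` (SIGMA es:avoiding V k S h m. ?X - ?A es))"
    using finite_avoiding[OF V(1)] finX by (intro card_mono finite_imageI finite_SigmaI) auto
  also have "\<dots> \<le> card (SIGMA es:avoiding V k S h m. ?X - ?A es)"
    using finite_avoiding[OF V(1)] finX by (intro card_image_le finite_SigmaI) auto
  also have "\<dots> = (\<Sum>es\<in>avoiding V k S h m. card (?X - ?A es))"
    using finite_avoiding[OF V(1)] finX by (intro card_SigmaI) auto
  finally have "real (card (avoiding V k S h (Suc m))) \<le> (\<Sum>es\<in>avoiding V k S h m. real (card (?X - ?A es)))"
    by (simp flip: of_nat_sum)
  also have "\<dots> \<le> (\<Sum>es\<in>avoiding V k S h m. ?a)"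
  proof (rule sum_mono)
    fix es assume es: "es \<in> avoiding V k S h m"
    have "real (card {f \<in> accepted es. 2 \<le> card (f \<inter> S)}) \<le> h"
      using es card_accepted_meeting_twice[of es S] by (simp add: avoiding_def)
    moreover have "finite f \<and> card f = k" if "f \<in> accepted es" for f
      using that es accepted_subset[of es] by (auto simp: avoiding_def nsets_def)
    ultimately have "real (card S choose k) / 2 \<le> real (card (?A es))"
      using card_available_ge[OF k fS V(3) h, of "accepted es"] by simp
    moreover have "?A es \<subseteq> ?X" using V by (auto simp: nsets_def)
    then have "real (card (?X - ?A es)) = real (card ?X) - real (card (?A es))"
      using finX by (rule real_card_Diff[rotated])
    ultimately show "real (card (?X - ?A es)) \<le> ?a" by simp
  qed
  also have "\<dots> = ?a * real (card (avoiding V k S h m))" by simp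
  also have "\<dots> \<le> ?a * ?a ^ m"
  proof (rule mult_left_mono[OF Suc.IH])
    have "card S choose k \<le> card V choose k"
      using V by (intro binomial_right_mono card_mono) auto
    then have "real (card S choose k) \<le> real (card V choose k)" by simp
    then show "0 \<le> ?a" by linarith
  qed
  finally show ?case by simp
qed

section \<open>Exponential moment of the number of hits\<close>

text \<open>Each draw contributes a factor 2 or 1 independently of the others, so the sum factorises
  over the positions.\<close>

lemma sum_two_power_filter:
  assumes "finite X"
  shows "(\<Sum>es | set es \<subseteq> X \<and> length es = m. (2::real) ^ length (filter P es))
    = (real (card X) + real (card {x \<in> X. P x})) ^ m"
proof (induction m)
  case 0
  have "{es. set es \<subseteq> X \<and> length es = 0} = {[]}" by auto
  then show ?case by simp
next
  case (Suc m)
  let ?L = "{es. set es \<subseteq> X \<and> length es = m}"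
  have "(\<Sum>x\<in>X. if P x then 2 else 1 :: real) = (\<Sum>x\<in>X. 1 + (if P x then 1 else 0))"
    by (rule sum.cong) auto
  also have "\<dots> = real (card X) + real (card {x \<in> X. P x})"
    using assms by (simp add: sum.distrib sum.If_cases Int_def)
  finally have weight: "(\<Sum>x\<in>X. if P x then 2 else 1 :: real) = real (card X) + real (card {x \<in> X. P x})" .
  have "(\<Sum>es | set es \<subseteq> X \<and> length es = Suc m. (2::real) ^ length (filter P es))
      = (\<Sum>(es, x)\<in>?L \<times> X. 2 ^ length (filter P (x # es)))"
    unfolding lists_length_Suc_eq by (subst sum.reindex) (auto simp: inj_on_def case_prod_unfold)
  also have "\<dots> = (\<Sum>(es, x)\<in>?L \<times> X. 2 ^ length (filter P es) * (if P x then 2 else 1))"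
    by (rule sum.cong) auto
  also have "\<dots> = (\<Sum>es\<in>?L. 2 ^ length (filter P es)) * (\<Sum>x\<in>X. if P x then 2 else 1)"
    unfolding sum_product sum.cartesian_product by simp
  finally show ?case unfolding Suc.IH weight by simp
qed

text \<open>Markov's inequality for 2 to the number of draws satisfying \<open>P\<close>.\<close>

lemma card_many_hits_le:
  fixes h :: real
  assumes "finite X"
  shows "real (card {es. set es \<subseteq> X \<and> length es = m \<and> h < real (length (filter P es))})
    \<le> (real (card X) + real (card {x \<in> X. P x})) ^ m / 2 powr h"
proof -
  let ?B = "{es. set es \<subseteq> X \<and> length es = m \<and> h < real (length (filter P es))}"
  let ?L = "{es. set es \<subseteq> X \<and> length es = m}"
  have finL: "finite ?L" using assms by (rule finite_lists_length_eq)
  have "real (card ?B) * 2 powr h = (\<Sum>es\<in>?B. 2 powr h)" by simp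
  also have "\<dots> \<le> (\<Sum>es\<in>?B. 2 ^ length (filter P es))"
    by (intro sum_mono) (auto simp flip: powr_realpow)
  also have "\<dots> \<le> (\<Sum>es\<in>?L. 2 ^ length (filter P es))"
    using finL by (intro sum_mono2) auto
  also have "\<dots> = (real (card X) + real (card {x \<in> X. P x})) ^ m"
    by (rule sum_two_power_filter[OF assms])
  finally show ?thesis by (simp add: pos_le_divide_eq)
qed

text \<open>Union bound over all \<open>s\<close>-sets \<open>S\<close>: a list is bad for
  \<open>S\<close> if it hits \<open>S\<close> too often or, despite few hits, leaves
  \<open>S\<close> independent. By \<open>few\<close>, the bad lists do not exhaust all lists of
  length \<open>m\<close>.\<close>

lemma exists_simple_kgraph_meeting_all:
  fixes h :: real and V :: "'a set"
  assumes k: "2 \<le> k" and V: "finite V" and s: "2 \<le> s"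
    and h: "2 * real k ^ 4 * h \<le> real s ^ 2"
    and few: "real (card V choose s) *
      ((real (card V choose k) + real ((s choose 2) * ((card V - 2) choose (k - 2)))) ^ m / 2 powr h
        + (real (card V choose k) - real (s choose k) / 2) ^ m) < real (card V choose k) ^ m"
  shows "\<exists>E. simple_kgraph k V E \<and> card E \<le> m \<and> (\<forall>S\<in>nsets V s. \<exists>f\<in>E. f \<subseteq> S)"
proof -
  let ?X = "nsets V k" and ?N = "real (card V choose k)"
  let ?L = "{es. set es \<subseteq> ?X \<and> length es = m}"
  let ?M = "\<lambda>S. {es. set es \<subseteq> ?X \<and> length es = m \<and> h < real (hits S es)}"
  let ?b = "(?N + real ((s choose 2) * ((card V - 2) choose (k - 2)))) ^ m / 2 powr h
        + (?N - real (s choose k) / 2) ^ m"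
  have finX: "finite ?X" and finS: "finite (nsets V s)" using V by (auto simp: finite_imp_finite_nsets)
  have finL: "finite ?L" using finX by (rule finite_lists_length_eq)
  have cL: "real (card ?L) = ?N ^ m" using finX by (simp add: card_lists_length_eq)
  have bad: "real (card (?M S \<union> avoiding V k S h m)) \<le> ?b" if "S \<in> nsets V s" for S
  proof -
    have S: "S \<subseteq> V" "card S = s" using that by (auto simp: nsets_def)
    have "S \<inter> V = S" using S by auto
    then have "card {e \<in> ?X. 2 \<le> card (e \<inter> S)} \<le> (s choose 2) * ((card V - 2) choose (k - 2))"
      using card_nsets_meeting_twice[OF V k, of S] S by (simp add: Int_commute)
    then have "real (card {e \<in> ?X. 2 \<le> card (e \<inter> S)}) \<le> real ((s choose 2) * ((card V - 2) choose (k - 2)))"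
      using of_nat_le_iff by blast
    then have "(?N + real (card {e \<in> ?X. 2 \<le> card (e \<inter> S)})) ^ m / 2 powr h
        \<le> (?N + real ((s choose 2) * ((card V - 2) choose (k - 2)))) ^ m / 2 powr h"
      by (intro divide_right_mono power_mono) auto
    with card_many_hits_le[OF finX, of m h "\<lambda>e. 2 \<le> card (e \<inter> S)"]
    have "real (card (?M S)) \<le> (?N + real ((s choose 2) * ((card V - 2) choose (k - 2)))) ^ m / 2 powr h"
      unfolding hits_def by simp
    moreover have "real (card (avoiding V k S h m)) \<le> (?N - real (s choose k) / 2) ^ m"
      using card_avoiding_le[OF k V S(1), of h m] S s h by simp
    moreover have "card (?M S \<union> avoiding V k S h m) \<le> card (?M S) + card (avoiding V k S h m)"
      by (rule card_Un_le)
    then have "real (card (?M S \<union> avoiding V k S h m)) \<le> real (card (?M S)) + real (card (avoiding V k S h m))"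
      by linarith
    ultimately show ?thesis by linarith
  qed
  let ?Bad = "\<Union>S\<in>nsets V s. ?M S \<union> avoiding V k S h m"
  have "card ?Bad \<le> (\<Sum>S\<in>nsets V s. card (?M S \<union> avoiding V k S h m))"
    using finS by (rule card_UN_le)
  then have "real (card ?Bad) \<le> (\<Sum>S\<in>nsets V s. real (card (?M S \<union> avoiding V k S h m)))"
    by (simp flip: of_nat_sum)
  also have "\<dots> \<le> (\<Sum>S\<in>nsets V s. ?b)" using bad by (rule sum_mono)
  also have "\<dots> = real (card V choose s) * ?b" by simp
  also have "\<dots> < real (card ?L)" unfolding cL by (rule few)
  finally have "card ?Bad < card ?L" by simp
  moreover have "finite ?Bad"
    by (rule finite_subset[OF _ finL]) (auto simp: avoiding_def)
  ultimately have "\<not> ?L \<subseteq> ?Bad" using card_mono leD by blast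
  then obtain es where es: "es \<in> ?L" "es \<notin> ?Bad" by blast
  have "\<exists>f\<in>accepted es. f \<subseteq> S" if "S \<in> nsets V s" for S
  proof -
    have "es \<notin> ?M S" "es \<notin> avoiding V k S h m" using that es(2) by blast+
    then show ?thesis using es(1) by (auto simp: avoiding_def not_less)
  qed
  moreover have "simple_kgraph k V (accepted es)"
    using simple_kgraph_accepted[OF V] es by blast
  moreover have "card (accepted es) \<le> m" using card_accepted_le[of es] es by simp
  ultimately show ?thesis by blast
qed

text \<open>The length \<open>m\<close> must be small enough to keep the expected hits well below
  the threshold, and large enough that failing to place an edge in \<open>S\<close> beats the at
  most \<open>n ^ s\<close> choices of \<open>S\<close>. Both failure probabilities come out as at
  most \<open>exp (-2 * s * ln n)\<close>.\<close>

lemma exists_small_independence_number: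
  fixes V :: "'a set" and k s m :: nat
  assumes k: "3 \<le> k" and V: "finite V" "card V = n" "3 \<le> n" "k \<le> n"
    and s: "3 \<le> s" "k \<le> s" "16 * real k ^ 4 * ln (real n) \<le> real s"
      "64 * real k ^ (k + 6) * real n ^ (k - 2) * ln (real n) \<le> real s ^ (k - 1)"
    and m: "real m \<le> real n ^ 2 / (8 * real k ^ 6)" "real n ^ 2 / (16 * real k ^ 6) \<le> real m"
  shows "\<exists>E. simple_kgraph k V E \<and> card E \<le> m \<and> (\<forall>S\<in>nsets V s. \<exists>f\<in>E. f \<subseteq> S)"
proof (rule exists_simple_kgraph_meeting_all[OF _ V(1)])
  \<comment> \<open>The largest threshold that still leaves half of the \<open>k\<close>-subsets of
    \<open>S\<close> available.\<close>
  define h where "h = real s ^ 2 / (2 * real k ^ 4)"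
  let ?N = "real (n choose k)" and ?Y = "real ((s choose 2) * ((n - 2) choose (k - 2)))"
  let ?b = "real (s choose k)"
  have k0: "0 < real k" and n0: "0 < real n" and s0: "0 < real s" using k V s by auto
  have N0: "0 < ?N" using V by simp
  have ln0: "0 < ln (real n)" using V by simp
  show "2 * real k ^ 4 * (real s ^ 2 / (2 * real k ^ 4)) \<le> real s ^ 2" using k0 by simp
  have Y: "real n ^ 2 * ?Y \<le> real k ^ 2 * real s ^ 2 * ?N"
  proof -
    have "real n ^ 2 * ?Y = real (s choose 2) * (real n ^ 2 * real ((n - 2) choose (k - 2)))" by simp
    also have "\<dots> \<le> real s ^ 2 / 2 * (2 * real k ^ 2 * ?N)"
      by (rule mult_mono[OF choose2_le choose_minus2_le]) (use k V in auto)
    finally show ?thesis by (simp add: mult_ac)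
  qed
  \<comment> \<open>A draw hits \<open>S\<close> with probability at most \<open>?Y / ?N\<close>, so
    the expected number of hits is at most \<open>h / 4\<close>.\<close>
  have mY: "real m * (?Y / ?N) \<le> real s ^ 2 / (8 * real k ^ 4)"
  proof -
    have "?Y / ?N \<le> real k ^ 2 * real s ^ 2 / real n ^ 2"
      using Y N0 n0 by (simp add: field_simps)
    then have "real m * (?Y / ?N) \<le> real n ^ 2 / (8 * real k ^ 6) * (real k ^ 2 * real s ^ 2 / real n ^ 2)"
      using m(1) by (intro mult_mono) auto
    also have "\<dots> = real s ^ 2 / (8 * real k ^ 4)"
      using k0 n0 by (simp add: field_simps flip: power_add)
    finally show ?thesis .
  qed
  have "(?N + ?Y) ^ m / 2 powr h \<le> ?N ^ m * exp (- 2 * real s * ln (real n))"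
  proof -
    have "?N + ?Y = ?N * (1 + ?Y / ?N)" using N0 by (simp add: field_simps)
    then have "(?N + ?Y) ^ m = ?N ^ m * (1 + ?Y / ?N) ^ m" by (simp only: power_mult_distrib)
    also have "\<dots> \<le> ?N ^ m * exp (?Y / ?N) ^ m"
      using exp_ge_add_one_self[of "?Y / ?N"] by (intro mult_left_mono power_mono) auto
    also have "\<dots> = ?N ^ m * exp (real m * (?Y / ?N))" by (simp only: exp_of_nat_mult)
    also have "\<dots> \<le> ?N ^ m * exp (real s ^ 2 / (8 * real k ^ 4))"
      using mY by (intro mult_left_mono) auto
    finally have 1: "(?N + ?Y) ^ m \<le> ?N ^ m * exp (real s ^ 2 / (8 * real k ^ 4))" .
    \<comment> \<open>This replaces \<open>2 powr h\<close> by \<open>exp (h / 2)\<close>; the mean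
      costs an exponent \<open>h / 4\<close>, so a gain of \<open>h / 4\<close> remains.\<close>
    have "1 / 2 \<le> ln (2 :: real)"
      using exp_half_le2 by (simp only: ln_ge_iff zero_less_numeral)
    then have "h * (1 / 2) \<le> h * ln 2"
      by (rule mult_left_mono) (simp add: h_def)
    then have 2: "exp (h / 2) \<le> 2 powr h" by (simp add: powr_def)
    have "(?N + ?Y) ^ m / 2 powr h \<le> ?N ^ m * exp (real s ^ 2 / (8 * real k ^ 4)) / exp (h / 2)"
      using 1 2 by (intro frac_le) auto
    also have "\<dots> = ?N ^ m * exp (real s ^ 2 / (8 * real k ^ 4) - h / 2)"
      by (simp add: exp_diff)
    also have "real s ^ 2 / (8 * real k ^ 4) - h / 2 = - (real s * real s / (8 * real k ^ 4))"
      by (simp add: h_def power2_eq_square)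
    also have "?N ^ m * exp (- (real s * real s / (8 * real k ^ 4))) \<le> ?N ^ m * exp (- 2 * real s * ln (real n))"
    proof -
      have "real s * (16 * real k ^ 4 * ln (real n)) \<le> real s * real s"
        using s by (intro mult_left_mono) auto
      then have "2 * real s * ln (real n) \<le> real s * real s / (8 * real k ^ 4)"
        using k0 by (simp add: field_simps)
      then show ?thesis by (intro mult_left_mono) auto
    qed
    finally show ?thesis .
  qed
  moreover have "(?N - ?b / 2) ^ m \<le> ?N ^ m * exp (- 2 * real s * ln (real n))"
    if sn: "s \<le> n"
  proof -
    let ?x = "?b / (2 * ?N)"
    have "s choose k \<le> n choose k" using sn by (rule binomial_right_mono)
    then have bN: "?b \<le> ?N" by simp
    have b: "(real s / real k) ^ k / real n ^ k \<le> ?b / ?N"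
    proof (rule frac_le)
      show "(real s / real k) ^ k \<le> ?b" using s(2) by (rule binomial_ge_n_over_k_pow_k)
      have "n choose k \<le> n ^ k" using V by (intro binomial_le_pow) auto
      then show "?N \<le> real n ^ k" by (metis of_nat_le_iff of_nat_power)
    qed (use N0 in auto)
    have kk: "k = k - 2 + 2" "k = Suc (k - 1)" using k by auto
    \<comment> \<open>Here the constant of the hypothesis on \<open>s ^ (k - 1)\<close> is used up:
      \<open>16 * k ^ 6\<close> comes from \<open>m\<close>, \<open>k ^ k\<close> from the binomial
      bound, one 2 from the halved \<open>?b\<close>, and one from the target exponent.\<close>
    have "2 * real s * ln (real n) = real s * (64 * real k ^ (k + 6) * real n ^ (k - 2) * ln (real n))
        / (32 * real k ^ (k + 6) * real n ^ (k - 2))"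
      using k0 n0 by simp
    also have "\<dots> \<le> real s * real s ^ (k - 1) / (32 * real k ^ (k + 6) * real n ^ (k - 2))"
      using s k0 n0 by (intro divide_right_mono mult_left_mono) auto
    also have "\<dots> = real n ^ 2 * real s ^ k / (32 * real k ^ (k + 6) * real n ^ k)"
    proof -
      have "real s * real s ^ (k - 1) = real s ^ k" by (subst (2) kk(2)) simp
      moreover have "real n ^ k = real n ^ (k - 2) * real n ^ 2" by (subst kk(1)) (simp only: power_add)
      ultimately show ?thesis using n0 by simp
    qed
    also have "\<dots> = real n ^ 2 / (16 * real k ^ 6) * ((real s / real k) ^ k / real n ^ k / 2)"
      by (simp add: power_divide power_add)
    also have "\<dots> \<le> real m * (?b / ?N / 2)"
      using m(2) b by (intro mult_mono divide_right_mono) auto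
    finally have mx: "2 * real s * ln (real n) \<le> real m * ?x" by simp
    have "?N - ?b / 2 = ?N * (1 - ?x)" using N0 by (simp add: field_simps)
    then have "(?N - ?b / 2) ^ m = ?N ^ m * (1 - ?x) ^ m" by (simp only: power_mult_distrib)
    also have "\<dots> \<le> ?N ^ m * exp (- ?x) ^ m"
      using exp_ge_add_one_self[of "- ?x"] bN N0
      by (intro mult_left_mono power_mono) (auto simp: divide_le_eq)
    also have "\<dots> = ?N ^ m * exp (- (real m * ?x))" by (simp flip: exp_of_nat_mult)
    also have "\<dots> \<le> ?N ^ m * exp (- 2 * real s * ln (real n))"
      using mx by (intro mult_left_mono) auto
    finally show ?thesis .
  qed
  ultimately have sum_le: "(?N + ?Y) ^ m / 2 powr h + (?N - ?b / 2) ^ m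
      \<le> 2 * (?N ^ m * exp (- 2 * real s * ln (real n)))" if "s \<le> n"
    using that by fastforce
  have "real (n choose s) * ((?N + ?Y) ^ m / 2 powr h + (?N - ?b / 2) ^ m) < ?N ^ m"
  proof (cases "s \<le> n")
    \<comment> \<open>There are no \<open>s\<close>-subsets at all, so the left side is 0.\<close>
    case False
    then show ?thesis using N0 by (simp add: binomial_eq_0)
  next
    case True
    then have "n choose s \<le> n ^ s" by (rule binomial_le_pow)
    then have "real (n choose s) \<le> real n ^ s" by (metis of_nat_le_iff of_nat_power)
    also have "\<dots> = exp (real s * ln (real n))" using n0 by (simp add: exp_of_nat_mult)
    finally have ns: "real (n choose s) \<le> exp (real s * ln (real n))" .
    have "real (n choose s) * ((?N + ?Y) ^ m / 2 powr h + (?N - ?b / 2) ^ m)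
        \<le> real (n choose s) * (2 * (?N ^ m * exp (- 2 * real s * ln (real n))))"
      using sum_le[OF True] by (intro mult_left_mono) auto
    also have "\<dots> \<le> exp (real s * ln (real n)) * (2 * (?N ^ m * exp (- 2 * real s * ln (real n))))"
      using ns by (intro mult_right_mono) auto
    also have "\<dots> = ?N ^ m * (2 * (exp (real s * ln (real n)) * exp (- 2 * real s * ln (real n))))" by simp
    also have "exp (real s * ln (real n)) * exp (- 2 * real s * ln (real n)) = exp (- (real s * ln (real n)))"
      by (simp flip: exp_add)
    \<comment> \<open>The remaining factor is at most \<open>2 / n\<close>, which is below 1 as
      \<open>3 \<le> n\<close>.\<close>
    also have "?N ^ m * (2 * exp (- (real s * ln (real n)))) < ?N ^ m * 1"
    proof (rule mult_strict_left_mono)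
      have "1 * ln (real n) \<le> real s * ln (real n)" using s ln0 by (intro mult_right_mono) auto
      then have "exp (- (real s * ln (real n))) \<le> exp (- ln (real n))" by simp
      also have "\<dots> = 1 / real n" using n0 by (simp add: exp_minus inverse_eq_divide)
      finally have "exp (- (real s * ln (real n))) \<le> 1 / real n" .
      moreover have "2 * (1 / real n) < 1" using V by simp
      ultimately show "2 * exp (- (real s * ln (real n))) < 1" by linarith
    qed (use N0 in simp)
    finally show ?thesis by simp
  qed
  then show "real (card V choose s) * ((real (card V choose k) + real ((s choose 2) * ((card V - 2) choose (k - 2)))) ^ m
      / 2 powr (real s ^ 2 / (2 * real k ^ 4)) + (real (card V choose k) - real (s choose k) / 2) ^ m)
      < real (card V choose k) ^ m"
    unfolding V(2) h_def .
qed (use k s in auto)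

subsection \<open>Counting extensions and covers\<close>

text \<open>Adding edges destroys independent sets and creates none, so every extension inherits the
  bound on independent sets from \<open>E0\<close>.\<close>

definition extensions :: "nat \<Rightarrow> 'a set \<Rightarrow> 'a set set \<Rightarrow> nat \<Rightarrow> 'a set set set" where
  "extensions k V E0 j = {E. simple_kgraph k V E \<and> E0 \<subseteq> E \<and> card (E - E0) = j}"

lemma finite_extensions:
  assumes "finite V"
  shows "finite (extensions k V E0 j)"
proof (rule finite_subset)
  show "extensions k V E0 j \<subseteq> Pow (nsets V k)"
    by (auto simp: extensions_def simple_kgraph_def kgraph_def)
qed (use assms in \<open>simp add: finite_imp_finite_nsets\<close>)

lemma finite_simple_kgraph: "simple_kgraph k V E \<Longrightarrow> finite E"
  by (auto simp: simple_kgraph_def kgraph_def intro: finite_subset finite_imp_finite_nsets)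

lemma card_compatible_ge:
  assumes G: "simple_kgraph k V E" and k: "2 \<le> k" and V: "2 \<le> card V"
    and E: "2 * real k ^ 4 * real (card E) \<le> real (card V) ^ 2"
  shows "real (card V choose k) / 2 \<le> real (card {e \<in> nsets V k. \<forall>f\<in>E. card (e \<inter> f) \<le> 1})"
proof (rule card_available_ge[OF k _ V E finite_simple_kgraph[OF G]])
  show "finite V" using G by (simp add: simple_kgraph_def kgraph_def)
  show "real (card {f \<in> E. 2 \<le> card (f \<inter> V)}) \<le> real (card E)"
    using finite_simple_kgraph[OF G] by (auto intro: card_mono)
  show "finite f \<and> card f = k" if "f \<in> E" for f
    using that G by (auto simp: simple_kgraph_def kgraph_def nsets_def)
qed

text \<open>Double counting of pairs of an extension and one added edge: a small extension accepts
  at least half of all \<open>k\<close>-sets, and a larger one arises in at most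
  \<open>Suc j\<close> ways.\<close>

lemma card_extensions_Suc:
  assumes V: "finite V" "2 \<le> card V" and k: "2 \<le> k"
    and E0: "simple_kgraph k V E0" "2 * real k ^ 4 * real (card E0 + j) \<le> real (card V) ^ 2"
  shows "real (card V choose k) / 2 * real (card (extensions k V E0 j))
    \<le> real (Suc j) * real (card (extensions k V E0 (Suc j)))"
proof -
  let ?A = "\<lambda>E. {e \<in> nsets V k. \<forall>f\<in>E. card (e \<inter> f) \<le> 1}"
  let ?X = "extensions k V E0"
  have fin: "finite (?X i)" for i using V(1) by (rule finite_extensions)
  have finE: "finite (E - E0)" if "E \<in> ?X i" for E i
    using that finite_simple_kgraph by (auto simp: extensions_def)
  \<comment> \<open>A set is never compatible with itself, as it meets itself in
    \<open>k \<ge> 2\<close> vertices.\<close>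
  have new: "e \<notin> E" if "e \<in> ?A E" for e E
  proof
    assume "e \<in> E"
    then have "card (e \<inter> e) \<le> 1" using that by blast
    then show False using that k by (auto simp: nsets_def)
  qed
  have "real (card V choose k) / 2 * real (card (?X j)) = (\<Sum>E\<in>?X j. real (card V choose k) / 2)"
    by simp
  also have "\<dots> \<le> (\<Sum>E\<in>?X j. real (card (?A E)))"
  proof (rule sum_mono)
    fix E assume E: "E \<in> ?X j"
    then have "E = E0 \<union> (E - E0)" "card (E - E0) = j" by (auto simp: extensions_def)
    then have "card E \<le> card E0 + j" by (metis card_Un_le)
    then have "2 * real k ^ 4 * real (card E) \<le> 2 * real k ^ 4 * real (card E0 + j)"
      by (intro mult_left_mono) auto
    then show "real (card V choose k) / 2 \<le> real (card (?A E))"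
      using E E0 by (intro card_compatible_ge k V) (auto simp: extensions_def)
  qed
  also have "\<dots> = real (card (SIGMA E:?X j. ?A E))"
    using fin V by (subst card_SigmaI) (auto simp: finite_imp_finite_nsets)
  also have "\<dots> \<le> real (card (SIGMA E:?X (Suc j). E - E0))"
  proof -
    have "card (SIGMA E:?X j. ?A E) \<le> card (SIGMA E:?X (Suc j). E - E0)"
    proof (rule card_inj_on_le)
      \<comment> \<open>The added edge is kept in the pair, so that the smaller graph can be
        recovered.\<close>
      show "inj_on (\<lambda>(E, e). (insert e E, e)) (SIGMA E:?X j. ?A E)"
      proof (rule inj_onI)
        fix p p' assume pp: "p \<in> (SIGMA E:?X j. ?A E)" "p' \<in> (SIGMA E:?X j. ?A E)"
          "(\<lambda>(E, e). (insert e E, e)) p = (\<lambda>(E, e). (insert e E, e)) p'"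
        obtain E e where p: "p = (E, e)" by (cases p)
        obtain E' e' where p': "p' = (E', e')" by (cases p')
        have "e \<in> ?A E" "e' \<in> ?A E'" using pp(1,2) unfolding p p' by blast+
        then have "e \<notin> E" "e' \<notin> E'" using new by blast+
        moreover have "insert e E = insert e' E'" "e = e'" using pp(3) unfolding p p' by auto
        ultimately show "p = p'" unfolding p p' by (simp add: insert_ident)
      qed
      show "(\<lambda>(E, e). (insert e E, e)) ` (SIGMA E:?X j. ?A E) \<subseteq> (SIGMA E:?X (Suc j). E - E0)"
      proof clarify
        fix E e assume E: "E \<in> ?X j" and e: "e \<in> nsets V k" "\<forall>f\<in>E. card (e \<inter> f) \<le> 1"
        then have "e \<notin> E" using new by blast
        have "finite E" "E0 \<subseteq> E" using E finite_simple_kgraph by (auto simp: extensions_def)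
        then have "e \<notin> E0" using \<open>e \<notin> E\<close> by blast
        then have "insert e E - E0 = insert e (E - E0)" by auto
        then have "card (insert e E - E0) = Suc j"
          using \<open>e \<notin> E\<close> \<open>finite E\<close> E by (simp add: extensions_def)
        then have "insert e E \<in> ?X (Suc j)"
          using E e by (auto simp: extensions_def simple_kgraph_def kgraph_def Int_commute)
        then show "insert e E \<in> ?X (Suc j) \<and> e \<in> insert e E - E0" using \<open>e \<notin> E0\<close> by blast
      qed
      show "finite (SIGMA E:?X (Suc j). E - E0)"
        using fin finE by (intro finite_SigmaI) auto
    qed
    then show ?thesis by simp
  qed
  also have "\<dots> = (\<Sum>E\<in>?X (Suc j). real (card (E - E0)))"
    using fin finE by simp
  also have "\<dots> = (\<Sum>E\<in>?X (Suc j). real (Suc j))"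
    by (rule sum.cong) (auto simp: extensions_def)
  also have "\<dots> = real (Suc j) * real (card (?X (Suc j)))" by simp
  finally show ?thesis .
qed

text \<open>Iterates the one-edge step, bounding each \<open>Suc j\<close> by \<open>m\<close>;
  using \<open>m ^ m\<close> in place of a factorial is harmless here.\<close>

lemma card_extensions_ge:
  assumes V: "finite V" "2 \<le> card V" and k: "2 \<le> k"
    and E0: "simple_kgraph k V E0" "2 * real k ^ 4 * real (card E0 + m) \<le> real (card V) ^ 2"
  shows "(real (card V choose k) / (2 * real m)) ^ m \<le> real (card (extensions k V E0 m))"
proof -
  have "j \<le> m \<Longrightarrow> (real (card V choose k) / (2 * real m)) ^ j \<le> real (card (extensions k V E0 j))" for j
  proof (induction j)
    case 0
    have "E0 \<in> extensions k V E0 0" using E0 by (simp add: extensions_def)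
    then have "1 \<le> card (extensions k V E0 0)"
      using finite_extensions[OF V(1), of k E0 0] by (metis One_nat_def Suc_leI card_gt_0_iff empty_iff)
    then show ?case by simp
  next
    case (Suc j)
    let ?N = "real (card V choose k)"
    have m: "0 < m" using Suc by simp
    have "2 * real k ^ 4 * real (card E0 + j) \<le> 2 * real k ^ 4 * real (card E0 + m)"
      using Suc by (intro mult_left_mono) auto
    then have "2 * real k ^ 4 * real (card E0 + j) \<le> real (card V) ^ 2" using E0 by linarith
    from card_extensions_Suc[OF V k E0(1) this]
    have step: "?N / 2 * real (card (extensions k V E0 j))
      \<le> real (Suc j) * real (card (extensions k V E0 (Suc j)))" .
    have "(?N / (2 * real m)) ^ Suc j = ?N / 2 * (?N / (2 * real m)) ^ j / real m" by simp
    also have "\<dots> \<le> ?N / 2 * real (card (extensions k V E0 j)) / real m"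
      using Suc by (intro divide_right_mono mult_left_mono) auto
    also have "\<dots> \<le> real (Suc j) * real (card (extensions k V E0 (Suc j))) / real m"
      using step by (intro divide_right_mono) auto
    also have "\<dots> \<le> real m * real (card (extensions k V E0 (Suc j))) / real m"
      using Suc by (intro divide_right_mono mult_right_mono) auto
    finally show ?case using m by simp
  qed
  then show ?thesis by blast
qed

section \<open>Encoding graphs by their covers\<close>

lemma card_small_subsets:
  assumes "finite V"
  shows "finite {I. I \<subseteq> V \<and> card I \<le> s}" "card {I. I \<subseteq> V \<and> card I \<le> s} \<le> (card V + 1) ^ s"
proof -
  let ?A = "insert None (Some ` V)" and ?S = "{I. I \<subseteq> V \<and> card I \<le> s}"
  let ?L = "{xs. set xs \<subseteq> ?A \<and> length xs = s}"
  have finL: "finite ?L" using assms by (intro finite_lists_length_eq) auto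
  have sub: "?S \<subseteq> (\<lambda>xs. Some -` set xs) ` ?L"
  proof
    fix I assume I: "I \<in> ?S"
    then have "finite I" using assms finite_subset by blast
    then obtain xs where xs: "set xs = I" "distinct xs" using finite_distinct_list by blast
    \<comment> \<open>Padding with \<open>None\<close> brings all the sets to lists of the same
      length \<open>s\<close>.\<close>
    let ?ys = "map Some xs @ replicate (s - card I) None"
    have "length xs = card I" using xs distinct_card by metis
    then have "length ?ys = s" using I by simp
    moreover have "set ?ys \<subseteq> ?A" using I xs by auto
    moreover have "Some -` set ?ys = I" using xs by auto
    ultimately show "I \<in> (\<lambda>xs. Some -` set xs) ` ?L"
      by (intro image_eqI[where x = ?ys]) (simp_all only: mem_Collect_eq)
  qed
  show "finite ?S" using finite_surj[OF finL sub] .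
  have "card ?S \<le> card ?L" using surj_card_le[OF finL sub] .
  also have "\<dots> = (card V + 1) ^ s"
    using assms by (subst card_lists_length_eq) (auto simp: card_image)
  finally show "card ?S \<le> (card V + 1) ^ s" .
qed

text \<open>Padding with empty sets, independent since edges are nonempty, gives all graphs of a
  family covers of a common length.\<close>

lemma indep_cover_theta_le:
  assumes G: "kgraph k V E" and k: "0 < k" and t: "theta k V E \<le> t"
  shows "\<exists>I. indep_cover k V E t I"
proof -
  obtain I where I: "indep_cover k V E (theta k V E) I" using theta_attained[OF G] by blast
  let ?J = "\<lambda>j. if j \<le> theta k V E then I j else {}"
  have "hindependent V E {}" using G k by (auto simp: hindependent_def kgraph_def nsets_def)
  then have "indep_cover k V E t ?J"
    using I t unfolding indep_cover_def by (force intro: bexI)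
  then show ?thesis by blast
qed

text \<open>Independent sets contain no edge, and every non-edge is covered, so the cover is a
  faithful encoding of the graph.\<close>

lemma indep_cover_determines_edges:
  assumes G: "kgraph k V E" and I: "indep_cover k V E t I"
  shows "E = {e \<in> nsets V k. \<forall>j\<in>{1..t}. \<not> e \<subseteq> I j}"
proof
  show "E \<subseteq> {e \<in> nsets V k. \<forall>j\<in>{1..t}. \<not> e \<subseteq> I j}"
    using G I by (auto simp: kgraph_def indep_cover_def hindependent_def)
  show "{e \<in> nsets V k. \<forall>j\<in>{1..t}. \<not> e \<subseteq> I j} \<subseteq> E"
    using I unfolding indep_cover_def kgraph_complement_def by blast
qed

lemma card_kgraphs_le:
  assumes V: "finite V" and k: "0 < k"
    and G: "\<And>E. E \<in> \<G> \<Longrightarrow> kgraph k V E \<and> theta k V E \<le> t \<and> (\<forall>I. hindependent V E I \<longrightarrow> card I \<le> s)"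
  shows "card \<G> \<le> ((card V + 1) ^ s) ^ t"
proof -
  let ?S = "{I. I \<subseteq> V \<and> card I \<le> s}"
  let ?edges = "\<lambda>I. {e \<in> nsets V k. \<forall>j\<in>{1..t}. \<not> e \<subseteq> I j}"
  have fin: "finite ({1..t} \<rightarrow>\<^sub>E ?S)" using card_small_subsets[OF V] by (intro finite_PiE) auto
  have "\<G> \<subseteq> ?edges ` ({1..t} \<rightarrow>\<^sub>E ?S)"
  proof
    fix E assume "E \<in> \<G>"
    then have E: "kgraph k V E" "theta k V E \<le> t" "\<And>I. hindependent V E I \<Longrightarrow> card I \<le> s"
      using G by auto
    obtain I where I: "indep_cover k V E t I" using indep_cover_theta_le[OF E(1) k E(2)] by blast
    \<comment> \<open>Values outside the index range are normalised, so that the covers form a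
      finite function space.\<close>
    have "restrict I {1..t} \<in> {1..t} \<rightarrow>\<^sub>E ?S"
      using I E(3) by (auto simp: indep_cover_def hindependent_def)
    moreover have "E = ?edges (restrict I {1..t})"
      by (subst indep_cover_determines_edges[OF E(1) I]) simp
    ultimately show "E \<in> ?edges ` ({1..t} \<rightarrow>\<^sub>E ?S)"
      by (intro image_eqI[where x = "restrict I {1..t}"])
  qed
  then have "card \<G> \<le> card ({1..t} \<rightarrow>\<^sub>E ?S)" using fin by (rule surj_card_le[rotated])
  also have "\<dots> = card ?S ^ t" by (simp add: card_funcsetE)
  also have "\<dots> \<le> ((card V + 1) ^ s) ^ t" using card_small_subsets[OF V] by (intro power_mono) auto
  finally show ?thesis .
qed

text \<open>There are at least \<open>sqrt n ^ m\<close> extensions of \<open>E0\<close> by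
  \<open>m\<close> edges, while covers encode at most \<open>(n ^ 2) ^ (s * ?T)\<close> graphs.
  Taking logarithms, \<open>ln n\<close> cancels.\<close>

lemma theta_s_ge_of_small_independence:
  fixes k s m n :: nat
  assumes k: "3 \<le> k" and n: "3 \<le> n" "real k ^ (2 * k) \<le> real n" "k \<le> n"
    and E0: "simple_kgraph k {..<n} E0" "card E0 \<le> m" "\<And>S. S \<in> nsets {..<n} s \<Longrightarrow> \<exists>f\<in>E0. f \<subseteq> S"
    and m: "0 < m" "real m \<le> real n ^ 2 / (8 * real k ^ 6)"
  shows "real m \<le> 4 * real s * real (theta_s n k)"
proof -
  let ?V = "{..<n}" and ?T = "theta_s n k" and ?N = "real (n choose k)"
  let ?X = "extensions k ?V E0 m"
  have k0: "1 \<le> real k" and n0: "0 < real n" using k n by auto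
  have "card ?X \<le> ((card ?V + 1) ^ s) ^ ?T"
  proof (rule card_kgraphs_le)
    fix E assume "E \<in> ?X"
    then have E: "simple_kgraph k ?V E" "E0 \<subseteq> E" by (auto simp: extensions_def)
    have "card I \<le> s" if I: "hindependent ?V E I" for I
    proof (rule ccontr)
      assume "\<not> card I \<le> s"
      then obtain S where S: "S \<subseteq> I" "card S = s" "finite S"
        using obtain_subset_with_card_n[of s I] by (metis nat_le_linear)
      then have "S \<in> nsets ?V s" using I by (auto simp: nsets_def hindependent_def)
      then obtain f where "f \<in> E0" "f \<subseteq> S" using E0(3) by blast
      then have "f \<in> E" "f \<subseteq> I" using E(2) S by auto
      then show False using I by (auto simp: hindependent_def)
    qed
    then show "kgraph k ?V E \<and> theta k ?V E \<le> ?T \<and> (\<forall>I. hindependent ?V E I \<longrightarrow> card I \<le> s)"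
      using E theta_le_theta_s[OF E(1)] by (simp add: simple_kgraph_def)
  qed (use k in auto)
  then have "real (card ?X) \<le> real (((n + 1) ^ s) ^ ?T)" by (simp only: of_nat_le_iff card_lessThan)
  also have "\<dots> = (real n + 1) ^ (s * ?T)" by (simp add: add.commute flip: power_mult)
  also have "\<dots> \<le> (real n ^ 2) ^ (s * ?T)"
  proof (rule power_mono)
    have "3 * real n \<le> real n * real n" using n by (intro mult_right_mono) auto
    then show "real n + 1 \<le> real n ^ 2" using n unfolding power2_eq_square by linarith
  qed simp
  finally have upper: "real (card ?X) \<le> (real n ^ 2) ^ (s * ?T)" .
  \<comment> \<open>Each new edge has at least about \<open>n ^ (k - 2) / k ^ k\<close> choices per
    position; \<open>3 \<le> k\<close> reduces this to \<open>n / k ^ k\<close>, and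
    \<open>k ^ (2 * k) \<le> n\<close> to \<open>sqrt n\<close>.\<close>
  have "sqrt (real n) ^ m \<le> (?N / (2 * real m)) ^ m"
  proof (rule power_mono)
    have "sqrt (real n) * real k ^ k \<le> sqrt (real n) * sqrt (real n)"
    proof (rule mult_left_mono)
      show "real k ^ k \<le> sqrt (real n)"
        using n(2) by (intro real_le_rsqrt) (simp add: mult.commute flip: power_mult)
    qed simp
    then have "sqrt (real n) \<le> real n / real k ^ k" using k0 by (simp add: pos_le_divide_eq)
    also have "\<dots> \<le> real n ^ (k - 2) / real k ^ k"
      using n k power_increasing[of 1 "k - 2" "real n"] by (intro divide_right_mono) auto
    also have "\<dots> = (real n / real k) ^ k / real n ^ 2"
    proof -
      have "k = k - 2 + 2" using k by simp
      then have "real n ^ k = real n ^ (k - 2) * real n ^ 2" by (metis power_add)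
      then show ?thesis using n0 by (simp add: power_divide)
    qed
    also have "\<dots> \<le> ?N / (2 * real m)"
    proof (rule frac_le)
      show "(real n / real k) ^ k \<le> ?N" using n(3) by (rule binomial_ge_n_over_k_pow_k)
      have "2 * real m \<le> real n ^ 2 / (4 * real k ^ 6)" using m by simp
      also have "\<dots> \<le> real n ^ 2 / 1"
      proof (rule divide_left_mono)
        show "1 \<le> 4 * real k ^ 6" using one_le_power[OF k0, of 6] by linarith
      qed (use k0 in auto)
      finally show "2 * real m \<le> real n ^ 2" by simp
    qed (use m in auto)
    finally show "sqrt (real n) \<le> ?N / (2 * real m)" .
  qed simp
  also have "\<dots> \<le> real (card ?X)"
  proof -
    \<comment> \<open>Even with \<open>2 * m\<close> edges in total, half of all
      \<open>k\<close>-sets stay compatible.\<close>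
    have "2 * real k ^ 4 * real (card E0 + m) \<le> 2 * real k ^ 4 * (2 * real m)"
      using E0 by (intro mult_left_mono) auto
    also have "\<dots> \<le> 2 * real k ^ 4 * (2 * (real n ^ 2 / (8 * real k ^ 6)))"
      using m by (intro mult_left_mono) auto
    also have "\<dots> = real n ^ 2 / (2 * real k ^ 2)" using k0 by (simp add: field_simps flip: power_add)
    also have "\<dots> \<le> real n ^ 2 / 1"
    proof (rule divide_left_mono)
      show "1 \<le> 2 * real k ^ 2" using one_le_power[OF k0, of 2] by linarith
    qed (use k0 in auto)
    finally show ?thesis using card_extensions_ge[of ?V k E0 m] E0 n k by simp
  qed
  finally have "sqrt (real n) ^ m \<le> (real n ^ 2) ^ (s * ?T)" using upper by linarith
  then have "ln (sqrt (real n) ^ m) \<le> ln ((real n ^ 2) ^ (s * ?T))" using n0 by (subst ln_le_cancel_iff) auto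
  then have "real m * (ln (real n) / 2) \<le> real (s * ?T) * (2 * ln (real n))"
    using n0 by (simp add: ln_realpow ln_sqrt)
  then have "real m * ln (real n) \<le> (4 * real s * real ?T) * ln (real n)" by simp
  moreover have "0 < ln (real n)" using n by simp
  ultimately show ?thesis by (simp only: mult_le_cancel_right_pos)
qed

text \<open>With \<open>s\<close> of order \<open>(n ^ (k - 2) * ln n) powr (1 / (k - 1))\<close>
  and \<open>m\<close> of order \<open>n ^ 2\<close>, the quotient \<open>m / s\<close> has the
  claimed order.\<close>

lemma theta_s_lower:
  fixes k :: nat
  assumes k: "3 \<le> k"
  shows "\<exists>(n0::nat) (c::real). 0 < c \<and>
    (\<forall>n\<ge>n0. c * real n powr (real k / (real k - 1)) / ln (real n) powr (1 / (real k - 1))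
      \<le> real (theta_s n k))"
proof -
  define a where "a = 1 / (real k - 1)"
  define A where "A = 64 * real k ^ (k + 6)"
  \<comment> \<open>The factor 128 is 16 from the lower bound on \<open>m\<close>, 4 from the
    counting inequality, and 2 from \<open>s \<le> 2 * r\<close>.\<close>
  define c where "c = 1 / (128 * real k ^ 6 * A powr a)"
  have a: "0 < a" "a * real (k - 1) = 1" using k by (auto simp: a_def of_nat_diff)
  have k0: "1 \<le> real k" using k by simp
  have A1: "1 \<le> A" using one_le_power[OF k0, of "k + 6"] by (simp add: A_def)
  have ev: "eventually (\<lambda>n::nat. 16 * real k ^ 4 * ln (real n) \<le> sqrt (real n)) sequentially"
    by real_asymp
  then obtain n1 where n1: "\<And>n. n1 \<le> n \<Longrightarrow> 16 * real k ^ 4 * ln (real n) \<le> sqrt (real n)"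
    unfolding eventually_sequentially by blast
  have "c * real n powr (real k / (real k - 1)) / ln (real n) powr (1 / (real k - 1))
      \<le> real (theta_s n k)"
    if n: "n1 + k ^ (2 * k) + 16 * k ^ 6 + 3 \<le> n" for n :: nat
  proof -
    have n3: "3 \<le> n" and nk: "k ^ (2 * k) \<le> n" and n6: "16 * k ^ 6 \<le> n" using n by auto
    have n0: "1 \<le> real n" using n3 by simp
    have ln1: "1 \<le> ln (real n)" using n3 exp_le by (subst ln_ge_iff) auto
    define r where "r = (A * real n ^ (k - 2) * ln (real n)) powr a"
    define s where "s = nat \<lceil>r\<rceil>"
    define m where "m = nat \<lfloor>real n ^ 2 / (8 * real k ^ 6)\<rfloor>"
    have pos: "0 < A * real n ^ (k - 2) * ln (real n)"
      using A1 n0 ln1 by (intro mult_pos_pos zero_less_power) linarith+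
    then have r0: "0 < r" unfolding r_def powr_gt_zero by (rule less_imp_neq[symmetric])
    then have "r ^ (k - 1) = r powr real (k - 1)" by (rule powr_realpow[symmetric])
    also have "\<dots> = (A * real n ^ (k - 2) * ln (real n)) powr (a * real (k - 1))"
      unfolding r_def by (rule powr_powr)
    finally have r_pow: "r ^ (k - 1) = A * real n ^ (k - 2) * ln (real n)"
      unfolding a(2) powr_one[OF less_imp_le[OF pos]] .
    \<comment> \<open>As \<open>3 \<le> k\<close>, the exponent \<open>(k - 2) / (k - 1)\<close> is
      at least 1/2, so \<open>r\<close> dominates \<open>sqrt n\<close> and thus the logarithmic
      bound required of \<open>s\<close>.\<close>
    have "sqrt (real n) = real n powr (1 / 2)" using n0 by (simp add: powr_half_sqrt)
    also have "\<dots> \<le> real n powr (real (k - 2) * a)"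
      using n0 k by (intro powr_mono) (auto simp: a_def field_simps of_nat_diff)
    also have "\<dots> = (1 * real n ^ (k - 2) * 1) powr a"
      using n0 by (simp add: powr_powr flip: powr_realpow)
    also have "\<dots> \<le> r" unfolding r_def
      using a A1 n0 ln1 by (intro powr_mono2 mult_mono) auto
    finally have rn: "sqrt (real n) \<le> r" .
    have sr: "r \<le> real s" "real s \<le> r + 1" using r0 by (auto simp: s_def)
    have "1 \<le> sqrt (real n)" using n0 by simp
    then have s2r: "real s \<le> 2 * r" using rn sr by linarith
    have s_big: "16 * real k ^ 4 * ln (real n) \<le> real s" using n1[of n] n rn sr by linarith
    have "16 * real k \<le> 16 * real k ^ 4" using k0 power_increasing[of 1 4 "real k"] by simp
    also have "\<dots> \<le> 16 * real k ^ 4 * ln (real n)"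
      using mult_left_mono[OF ln1, of "16 * real k ^ 4"] by simp
    finally have "16 * real k \<le> real s" using s_big by linarith
    then have sk: "k \<le> s" "3 \<le> s" using k by auto
    have s_pow: "64 * real k ^ (k + 6) * real n ^ (k - 2) * ln (real n) \<le> real s ^ (k - 1)"
      using power_mono[OF sr(1), of "k - 1"] r0 unfolding r_pow A_def by simp
    have n_m: "16 * real k ^ 6 \<le> real n ^ 2"
    proof -
      have "real (16 * k ^ 6) \<le> real n" using n6 of_nat_le_iff by blast
      also have "\<dots> \<le> real n ^ 2" using power_increasing[of 1 2 "real n"] n0 by simp
      finally show ?thesis by simp
    qed
    \<comment> \<open>Rounding a number that is at least 2 down loses at most half of it, so
      \<open>m\<close> is positive and meets its lower bound.\<close>
    then have "2 \<le> real n ^ 2 / (8 * real k ^ 6)" using k0 by (simp add: pos_le_divide_eq)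
    moreover have "real n ^ 2 / (8 * real k ^ 6) = 2 * (real n ^ 2 / (16 * real k ^ 6))" by simp
    ultimately have m: "real m \<le> real n ^ 2 / (8 * real k ^ 6)" "real n ^ 2 / (16 * real k ^ 6) \<le> real m"
      "0 < m"
      unfolding m_def by linarith+
    have "k ^ 1 \<le> k ^ (2 * k)" using k by (intro power_increasing) auto
    then have kn: "k \<le> n" using nk by simp
    have kn2: "real k ^ (2 * k) \<le> real n" using nk by (metis of_nat_le_iff of_nat_power)
    obtain E where "simple_kgraph k {..<n} E" "card E \<le> m" "\<forall>S\<in>nsets {..<n} s. \<exists>f\<in>E. f \<subseteq> S"
      using exists_small_independence_number[OF k, of "{..<n}" n s m] n3 kn sk s_big s_pow m by auto
    then have mT: "real m \<le> 4 * real s * real (theta_s n k)"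
      using theta_s_ge_of_small_independence[OF k n3 kn2 kn _ _ _ m(3,1)] by blast
    have "real n ^ 2 / (16 * real k ^ 6) \<le> 4 * real s * real (theta_s n k)" using m mT by linarith
    also have "\<dots> \<le> 4 * (2 * r) * real (theta_s n k)"
      using s2r by (intro mult_right_mono) auto
    finally have "real n ^ 2 / (16 * real k ^ 6) \<le> real (theta_s n k) * (8 * r)" by (simp add: mult_ac)
    then have "real n ^ 2 / (16 * real k ^ 6) / (8 * r) \<le> real (theta_s n k)"
      using r0 by (subst pos_divide_le_eq) simp_all
    then have "real n ^ 2 / (128 * real k ^ 6) / r \<le> real (theta_s n k)" by simp
    moreover have "real n ^ 2 / (128 * real k ^ 6) / r
      = c * real n powr (real k / (real k - 1)) / ln (real n) powr (1 / (real k - 1))"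
    proof -
      have "real k / (real k - 1) + real (k - 2) * a = 2 * (real k - 1) / (real k - 1)"
        using k by (simp add: a_def of_nat_diff flip: add_divide_distrib)
      also have "\<dots> = 2" using k by (intro nonzero_mult_div_cancel_right) simp
      finally have exps: "real k / (real k - 1) + real (k - 2) * a = 2" .
      have "real n ^ 2 = real n powr 2" using n0 by (simp add: powr_numeral)
      also have "\<dots> = real n powr (real k / (real k - 1) + real (k - 2) * a)" by (simp only: exps)
      also have "\<dots>
        = real n powr (real k / (real k - 1)) * real n powr (real (k - 2) * a)" by (rule powr_add)
      finally have "real n ^ 2 = real n powr (real k / (real k - 1)) * real n powr (real (k - 2) * a)" .
      moreover have "r = A powr a * real n powr (real (k - 2) * a) * ln (real n) powr (1 / (real k - 1))"
        using n0 A1 ln1 by (simp add: r_def powr_mult powr_powr flip: powr_realpow) (simp add: a_def)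
      moreover have "0 < real n powr (real (k - 2) * a)" using n0 by simp
      ultimately show ?thesis by (simp add: c_def)
    qed
    ultimately show ?thesis by simp
  qed
  moreover have "0 < c" using k0 A1 by (simp add: c_def)
  ultimately show ?thesis by blast
qed

theorem theorem2p3:
  fixes k :: nat
  assumes "k \<ge> 3"
  shows "\<exists>(n0::nat) (c1::real) (c2::real). c1 > 0 \<and> c2 > 0 \<and>
    (\<forall>n::nat. n \<ge> n0 \<longrightarrow>
      c1 * real n powr (real k / (real k - 1)) / ln (real n) powr (1 / (real k - 1))
        \<le> real (theta_s n k) \<and>
      real (theta_s n k) \<le> c2 * real n powr (real k / (real k - 1)) * ln (real n))"
proof -
  obtain n1 c1 where 1: "0 < c1" "\<forall>n\<ge>n1. c1 * real n powr (real k / (real k - 1))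
      / ln (real n) powr (1 / (real k - 1)) \<le> real (theta_s n k)"
    using theta_s_lower[OF assms] by blast
  obtain n2 c2 where 2: "0 < c2" "\<forall>n\<ge>n2. real (theta_s n k)
      \<le> c2 * real n powr (real k / (real k - 1)) * ln (real n)"
    using theta_s_upper[OF assms] by blast
  show ?thesis
    using 1 2 by (intro exI[of _ "max n1 n2"] exI[of _ c1] exI[of _ c2]) auto
qed

end
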